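(* Let $\mathcal A=(a_{ij})$, $\mathcal B=(b_{ij})$ be symmetric $3\times3$ matrices (indices $0,1,2$) and let $\mathcal R$ be the ring of polynomials over $\mathbb Z$ in the 12 independent entries $a_{ij},b_{ij}$ regarded as indeterminates. With $\mathbf V(s,t)=(s^2,st,t^2)^T$, $\mathbf F(s,t)=(\mathcal A\mathbf V(s,t))\times(\mathcal B\mathbf V(s,t))=(F^{(1)},F^{(2)},F^{(3)})^T$ and $Q(s,t)=(F^{(2)})^2-F^{(1)}F^{(3)}$, consider the system $$r_nr_{n-1}=Q(s_n,t_n),\quad s_{n+1}r_{n-1}=t_{n-1}F^{(1)}(s_n,t_n)-s_{n-1}F^{(2)}(s_n,t_n),\quad t_{n+1}r_{n-1}=t_{n-1}F^{(2)}(s_n,t_n)-s_{n-1}F^{(3)}(s_n,t_n),$$ for $n\ge1$, with independent indeterminate initial values $r_0,s_0,s_1,t_0,t_1$. Then the system has the Laurent property: for all $n\ge0$, $r_n,s_n,t_n\in\hat{\mathcal R}:=\mathcal R[r_0^{\pm1},s_0,s_1,t_0,t_1]$.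
   Context: The ratio $u_n=s_n/t_n$ is an iterate of the symmetric QRT map $u_{n+1}=\frac{f^{(1)}(u_n)-u_{n-1}f^{(2)}(u_n)}{f^{(2)}(u_n)-u_{n-1}f^{(3)}(u_n)}$, $\mathbf f(u)=\mathbf F(u,1)$. *)

theory Defs
  imports "HOL-Library.Poly_Mapping" "HOL-Computational_Algebra.Fraction_Field"
begin

definition Vv :: "'a::comm_ring_1 \<Rightarrow> 'a \<Rightarrow> nat \<Rightarrow> 'a" where
  "Vv s t i = (if i = 0 then s^2 else if i = 1 then s*t else t^2)"

definition matvec :: "(nat \<Rightarrow> nat \<Rightarrow> 'a::comm_ring_1) \<Rightarrow> (nat \<Rightarrow> 'a) \<Rightarrow> nat \<Rightarrow> 'a" where
  "matvec M v i = (\<Sum>j<3. M i j * v j)"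

definition cross3 :: "(nat \<Rightarrow> 'a::comm_ring_1) \<Rightarrow> (nat \<Rightarrow> 'a) \<Rightarrow> nat \<Rightarrow> 'a" where
  "cross3 u v i = (if i = 0 then u 1 * v 2 - u 2 * v 1
                  else if i = 1 then u 2 * v 0 - u 0 * v 2
                  else u 0 * v 1 - u 1 * v 0)"

text \<open>FF A B s t 0, 1, 2 are F^(1), F^(2), F^(3).\<close>
definition FF :: "(nat \<Rightarrow> nat \<Rightarrow> 'a::comm_ring_1) \<Rightarrow> (nat \<Rightarrow> nat \<Rightarrow> 'a) \<Rightarrow> 'a \<Rightarrow> 'a \<Rightarrow> nat \<Rightarrow> 'a" where
  "FF A B s t = cross3 (matvec A (Vv s t)) (matvec B (Vv s t))"

definition QQ :: "(nat \<Rightarrow> nat \<Rightarrow> 'a::comm_ring_1) \<Rightarrow> (nat \<Rightarrow> nat \<Rightarrow> 'a) \<Rightarrow> 'a \<Rightarrow> 'a \<Rightarrow> 'a" where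
  "QQ A B s t = (FF A B s t 1)^2 - FF A B s t 0 * FF A B s t 2"

fun qrt :: "(nat \<Rightarrow> nat \<Rightarrow> 'a::field) \<Rightarrow> (nat \<Rightarrow> nat \<Rightarrow> 'a) \<Rightarrow> 'a \<Rightarrow> 'a \<Rightarrow> 'a \<Rightarrow> 'a \<Rightarrow> 'a \<Rightarrow> nat \<Rightarrow> 'a \<times> 'a \<times> 'a" where
  "qrt A B r0 s0 s1 t0 t1 0 = (r0, s0, t0)"
| "qrt A B r0 s0 s1 t0 t1 (Suc 0) = (QQ A B s1 t1 / r0, s1, t1)"
| "qrt A B r0 s0 s1 t0 t1 (Suc (Suc n)) =
     (let (rp, sp, tp) = qrt A B r0 s0 s1 t0 t1 n;
          (r, s, t) = qrt A B r0 s0 s1 t0 t1 (Suc n);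
          s2 = (tp * FF A B s t 0 - sp * FF A B s t 1) / rp;
          t2 = (tp * FF A B s t 1 - sp * FF A B s t 2) / rp;
          r2 = QQ A B s2 t2 / r
      in (r2, s2, t2))"

type_synonym mpoly = "(nat \<Rightarrow>\<^sub>0 nat) \<Rightarrow>\<^sub>0 int"

definition Xv :: "nat \<Rightarrow> mpoly" where
  "Xv i = Poly_Mapping.single (Poly_Mapping.single i 1) 1"

definition Xf :: "nat \<Rightarrow> mpoly fract" where
  "Xf i = Fract (Xv i) 1"

text \<open>Indeterminate numbering: a_ij (symmetric, i,j < 3) uses 0..5, b_ij uses 6..11,
  r0 = 12, s0 = 13, s1 = 14, t0 = 15, t1 = 16.\<close>
definition symidx :: "nat \<Rightarrow> nat \<Rightarrow> nat" where
  "symidx i j = (let p = min i j; q = max i j in 3 * p - (p * (p - 1)) div 2 + (q - p))"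

definition genA :: "nat \<Rightarrow> nat \<Rightarrow> mpoly fract" where "genA i j = Xf (symidx i j)"
definition genB :: "nat \<Rightarrow> nat \<Rightarrow> mpoly fract" where "genB i j = Xf (6 + symidx i j)"

text \<open>Membership in R-hat = Z[a_ij,b_ij][r0^{+-1}, s0, s1, t0, t1]: a polynomial with integer
  coefficients in the 17 indeterminates divided by a power of r0.\<close>
definition in_Rhat :: "mpoly fract \<Rightarrow> bool" where
  "in_Rhat x \<longleftrightarrow> (\<exists>p k. (\<forall>m\<in>Poly_Mapping.keys p. Poly_Mapping.keys m \<subseteq> {..<17})
                         \<and> x = Fract p (Xv 12 ^ k))"

end

theory Submission
  imports "HOL-Computational_Algebra.Polynomial" Defs
begin

text \<open>
  Write \<open>v n = (s n, t n)\<close>. The biquadratic form \<open>V(v n)\<^sup>T A V(v (n - 1))\<close>, divided by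
  \<open>r (n - 1)\<close>, is constant along an orbit, and so is the one of \<open>B\<close>. This makes
  \<open>s 1 * s 3\<close>, \<open>t 1 * t 3\<close> and \<open>s 1 * t 3 + t 1 * s 3\<close> Laurent polynomials, and since \<open>s 1\<close> and \<open>t 1\<close>
  are coprime, \<open>v 3\<close> is a pair of Laurent polynomials; likewise \<open>r 2\<close>.
  Every later iterate \<open>z\<close> is then treated by the caterpillar argument: restarting the orbit at times 1
  and 2 and using induction, \<open>r 1 ^ k * z\<close> and \<open>r 2 ^ l * z\<close> are Laurent polynomials,
  and it remains to see that \<open>r 2\<close> is coprime to \<open>Q(v 1) = r 0 * r 1\<close>.

  Coprimality is understood as a regular-sequence condition. If \<open>Q(v 1)\<close> divides \<open>r 2 * x\<close>, regard
  \<open>Q(v 1)\<close> as a quadratic in \<open>a 0 0\<close> and multiply by the norm of \<open>r 2\<close> modulo this quadratic; the norm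
  is free of \<open>a 0 0\<close> and nonzero by a specialisation, so \<open>Q(v 1)\<close> divides \<open>x\<close> up to a power of its leading
  coefficient. The same holds for \<open>a 2 2\<close>, and the two leading coefficients are coprime.
\<close>

subsection \<open>Laurent polynomials and substitution\<close>

definition monom_at :: "(nat \<Rightarrow> 'a::comm_ring_1) \<Rightarrow> (nat \<Rightarrow>\<^sub>0 nat) \<Rightarrow> 'a" where
  "monom_at d m = (\<Prod>i\<in>Poly_Mapping.keys m. d i ^ Poly_Mapping.lookup m i)"

definition mpoly_at :: "(nat \<Rightarrow> 'a::comm_ring_1) \<Rightarrow> mpoly \<Rightarrow> 'a" where
  "mpoly_at d p = (\<Sum>m\<in>Poly_Mapping.keys p. of_int (Poly_Mapping.lookup p m) * monom_at d m)"

lemma monom_at_superset: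
  assumes "finite I" "Poly_Mapping.keys m \<subseteq> I"
  shows "monom_at d m = (\<Prod>i\<in>I. d i ^ Poly_Mapping.lookup m i)"
  unfolding monom_at_def using assms by (intro prod.mono_neutral_left) (auto simp: in_keys_iff)

lemma monom_at_add: "monom_at d (m + m') = monom_at d m * monom_at d m'"
proof -
  let ?I = "Poly_Mapping.keys m \<union> Poly_Mapping.keys m'"
  have "monom_at d (m + m') = (\<Prod>i\<in>?I. d i ^ Poly_Mapping.lookup (m + m') i)"
    using Poly_Mapping.keys_add[of m m'] by (intro monom_at_superset) auto
  also have "\<dots> = monom_at d m * monom_at d m'"
    by (simp add: monom_at_superset[of ?I] lookup_add power_add prod.distrib)
  finally show ?thesis .
qed

lemma mpoly_at_superset:
  assumes "finite I" "Poly_Mapping.keys p \<subseteq> I"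
  shows "mpoly_at d p = (\<Sum>m\<in>I. of_int (Poly_Mapping.lookup p m) * monom_at d m)"
  unfolding mpoly_at_def using assms by (intro sum.mono_neutral_left) (auto simp: in_keys_iff)

lemma mpoly_at_zero [simp]: "mpoly_at d 0 = 0"
  by (simp add: mpoly_at_def)

lemma mpoly_at_diff: "mpoly_at d (p - q) = mpoly_at d p - mpoly_at d q"
proof -
  let ?I = "Poly_Mapping.keys p \<union> Poly_Mapping.keys q"
  have "mpoly_at d (p - q) = (\<Sum>m\<in>?I. of_int (Poly_Mapping.lookup (p - q) m) * monom_at d m)"
    using keys_diff[of p q] by (intro mpoly_at_superset) auto
  also have "\<dots> = mpoly_at d p - mpoly_at d q"
    by (simp add: mpoly_at_superset[of ?I] lookup_minus algebra_simps sum_subtractf)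
  finally show ?thesis .
qed

lemma mpoly_at_single: "mpoly_at d (Poly_Mapping.single m 1) = monom_at d m"
  by (simp add: mpoly_at_def)

lemma mpoly_at_one [simp]: "mpoly_at d 1 = 1"
  using mpoly_at_single[of d 0] by (simp add: monom_at_def)

lemma mpoly_at_Xv [simp]: "mpoly_at d (Xv i) = d i"
  by (simp add: Xv_def mpoly_at_single monom_at_def)

text \<open>Both sides are additive in each factor, and integer polynomials form the free abelian
  group on the monomials. Two nested uses of \<open>frag_induction\<close> therefore reduce the
  claim to a product of two monomials.\<close>

lemma mpoly_at_mult: "mpoly_at d (p * q) = mpoly_at d p * mpoly_at d q"
proof (rule frag_induction[OF subset_UNIV, of "\<lambda>p. mpoly_at d (p * q) = mpoly_at d p * mpoly_at d q"])
  fix m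
  show "mpoly_at d (frag_of m * q) = mpoly_at d (frag_of m) * mpoly_at d q"
    by (rule frag_induction[OF subset_UNIV, of "\<lambda>q. mpoly_at d (frag_of m * q) = mpoly_at d (frag_of m) * mpoly_at d q"])
      (simp_all add: mult_single mpoly_at_single monom_at_add mpoly_at_diff algebra_simps)
qed (simp_all add: mpoly_at_diff algebra_simps)

lemma mpoly_at_power: "mpoly_at d (p ^ k) = mpoly_at d p ^ k"
  by (induction k) (simp_all add: mpoly_at_mult)

lemma Xv_nonzero [simp]: "Xv i \<noteq> 0"
  using mpoly_at_Xv[of "\<lambda>_. 1 :: int" i] by (metis mpoly_at_zero zero_neq_one)

lemma Xf_nonzero [simp]: "Xf i \<noteq> 0"
  by (simp add: Xf_def Zero_fract_def eq_fract)

lemma inj_Xf: "inj Xf"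
proof (rule injI)
  fix i j assume "Xf i = Xf j"
  then have "Poly_Mapping.single i (1::nat) = Poly_Mapping.single j 1"
    by (simp add: Xf_def eq_fract Xv_def frag_of_eq)
  then have "{i} = {j}"
    by (metis keys_single zero_neq_one)
  then show "i = j" by simp
qed

text \<open>The ring generated by the chosen indeterminates and the inverse of \<open>r 0\<close>.
  The index set is a parameter so that one indeterminate can be split off: for \<open>j\<close> in
  \<open>S\<close>, \<open>localised S\<close> is generated by \<open>Xf j\<close> over
  \<open>localised (S - {j})\<close>.\<close>

inductive_set localised :: "nat set \<Rightarrow> mpoly fract set" for S where
  localised_one: "1 \<in> localised S"
| localised_var: "i \<in> S \<Longrightarrow> Xf i \<in> localised S"
| localised_inverse: "inverse (Xf 12) \<in> localised S"
| localised_diff: "x \<in> localised S \<Longrightarrow> y \<in> localised S \<Longrightarrow> x - y \<in> localised S"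
| localised_mult: "x \<in> localised S \<Longrightarrow> y \<in> localised S \<Longrightarrow> x * y \<in> localised S"

abbreviation laurent_ring :: "mpoly fract set" where
  "laurent_ring \<equiv> localised {..<17}"

text \<open>Substituting \<open>d\<close> for the indeterminates is a ring homomorphism on Laurent polynomials;
  it is encoded by its graph, so that compatibility with the ring operations is built in.\<close>
inductive substitutes :: "(nat \<Rightarrow> 'a::field) \<Rightarrow> mpoly fract \<Rightarrow> 'a \<Rightarrow> bool" for d where
  substitutes_one: "substitutes d 1 1"
| substitutes_var: "i < 17 \<Longrightarrow> substitutes d (Xf i) (d i)"
| substitutes_inverse: "substitutes d (inverse (Xf 12)) (inverse (d 12))"
| substitutes_diff: "substitutes d x y \<Longrightarrow> substitutes d x' y' \<Longrightarrow> substitutes d (x - x') (y - y')"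
| substitutes_mult: "substitutes d x y \<Longrightarrow> substitutes d x' y' \<Longrightarrow> substitutes d (x * x') (y * y')"

lemma Fract_diff_common:
  fixes u :: "'a::idom"
  assumes "u \<noteq> 0"
  shows "Fract p (u ^ k) - Fract q (u ^ l) = Fract (p * u ^ l - q * u ^ k) (u ^ (k + l))"
  using assms by (simp add: power_add)

text \<open>Every pair in the graph comes from evaluating numerator and denominator of one explicit
  fraction. This normal form is what makes the relation single-valued.\<close>

lemma substitutes_Fract:
  assumes "substitutes d x y" "d 12 \<noteq> 0"
  shows "\<exists>p k. x = Fract p (Xv 12 ^ k) \<and> y = mpoly_at d p / d 12 ^ k"
  using assms(1)
proof induction
  case substitutes_one
  show ?case by (intro exI[of _ 1] exI[of _ 0]) (simp add: One_fract_def)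
next
  case (substitutes_var i)
  show ?case by (intro exI[of _ "Xv i"] exI[of _ 0]) (simp add: Xf_def)
next
  case substitutes_inverse
  show ?case by (intro exI[of _ 1] exI[of _ 1]) (simp add: Xf_def divide_inverse)
next
  case (substitutes_diff x y x' y')
  then obtain p k p' k' where "x = Fract p (Xv 12 ^ k)" "y = mpoly_at d p / d 12 ^ k"
    "x' = Fract p' (Xv 12 ^ k')" "y' = mpoly_at d p' / d 12 ^ k'"
    by blast
  with assms(2) show ?case
    by (intro exI[of _ "p * Xv 12 ^ k' - p' * Xv 12 ^ k"] exI[of _ "k + k'"])
      (simp add: Fract_diff_common mpoly_at_diff mpoly_at_mult mpoly_at_power diff_frac_eq power_add
        del: diff_fract)
next
  case (substitutes_mult x y x' y')
  then obtain p k p' k' where "x = Fract p (Xv 12 ^ k)" "y = mpoly_at d p / d 12 ^ k"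
    "x' = Fract p' (Xv 12 ^ k')" "y' = mpoly_at d p' / d 12 ^ k'"
    by blast
  with assms(2) show ?case
    by (intro exI[of _ "p * p'"] exI[of _ "k + k'"])
      (simp add: mpoly_at_mult mpoly_at_power power_add)
qed

lemma substitutes_zero: "substitutes d 0 0"
  using substitutes_diff[OF substitutes_one substitutes_one, of d] by simp

text \<open>The graph is closed under differences, so only the values of 0 matter; a fraction equal
  to 0 has numerator 0, which evaluates to 0.\<close>

lemma substitutes_unique:
  assumes "substitutes d x y" "substitutes d x y'" "d 12 \<noteq> 0"
  shows "y = y'"
proof -
  have "substitutes d (x - x) (y - y')"
    by (intro substitutes_diff assms)
  from substitutes_Fract[OF this assms(3)] obtain p k
    where "0 = Fract p (Xv 12 ^ k)" "y - y' = mpoly_at d p / d 12 ^ k"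
    by auto
  then show ?thesis
    by (simp add: Zero_fract_def eq_fract)
qed

lemma substitutes_uminus: "substitutes d x y \<Longrightarrow> substitutes d (- x) (- y)"
  using substitutes_diff[OF substitutes_zero, of d x y] by simp

lemma substitutes_add:
  "substitutes d x y \<Longrightarrow> substitutes d x' y' \<Longrightarrow> substitutes d (x + x') (y + y')"
  using substitutes_diff[OF _ substitutes_uminus, of d x y x' y'] by simp

lemma substitutes_power: "substitutes d x y \<Longrightarrow> substitutes d (x ^ k) (y ^ k)"
  by (induction k) (auto intro: substitutes_one substitutes_mult)

lemmas substitutes_intros = substitutes_zero substitutes_one substitutes_var substitutes_inverse
  substitutes_diff substitutes_mult substitutes_uminus substitutes_add substitutes_power

lemma localised_zero: "0 \<in> localised S"
  using localised_diff[OF localised_one localised_one] by simp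

lemma localised_uminus: "x \<in> localised S \<Longrightarrow> - x \<in> localised S"
  using localised_diff[OF localised_zero, of x S] by simp

lemma localised_add: "x \<in> localised S \<Longrightarrow> y \<in> localised S \<Longrightarrow> x + y \<in> localised S"
  using localised_diff[OF _ localised_uminus, of x S y] by simp

lemma localised_power: "x \<in> localised S \<Longrightarrow> x ^ k \<in> localised S"
  by (induction k) (auto intro: localised_one localised_mult)

lemma localised_numeral: "numeral k \<in> localised S"
proof -
  have "of_nat n \<in> localised S" for n
    by (induction n) (auto intro: localised_zero localised_one localised_add)
  from this[of "numeral k"] show ?thesis by simp
qed

lemma localised_sum: "(\<And>i. i \<in> I \<Longrightarrow> f i \<in> localised S) \<Longrightarrow> sum f I \<in> localised S"
  by (induction I rule: infinite_finite_induct) (auto intro: localised_zero localised_add)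

lemmas localised_intros = localised_zero localised_one localised_var localised_inverse
  localised_diff localised_mult localised_uminus localised_add localised_power localised_numeral

lemma localised_mono: "x \<in> localised S \<Longrightarrow> S \<subseteq> T \<Longrightarrow> x \<in> localised T"
  by (induction rule: localised.induct) (auto intro: localised_intros)

lemma substitutes_exists:
  assumes "x \<in> laurent_ring"
  obtains y where "substitutes d x y"
proof -
  from assms have "\<exists>y. substitutes d x y"
    by induction (use substitutes_var in \<open>blast intro: substitutes_intros\<close>)+
  with that show ?thesis by blast
qed

text \<open>Allows one indeterminate to be replaced while the coefficients, which do not involve it,
  stay fixed.\<close>

lemma substitutes_self:
  assumes "x \<in> localised S" "S \<subseteq> {..<17}" "\<And>i. i \<in> insert 12 S \<Longrightarrow> d i = Xf i"
  shows "substitutes d x x"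
  using assms
proof (induction rule: localised.induct)
  case (localised_var i)
  then show ?case using substitutes_var[of i d] by auto
next
  case localised_inverse
  then show ?case using substitutes_inverse[of d] by simp
qed (auto intro: substitutes_intros)

lemma localised_in_Rhat:
  assumes "x \<in> laurent_ring"
  shows "in_Rhat x"
proof -
  define poly_in where "poly_in p \<longleftrightarrow> (\<forall>m\<in>Poly_Mapping.keys p. Poly_Mapping.keys m \<subseteq> {..<17::nat})"
    for p :: mpoly
  have one: "poly_in 1"
    by (simp add: poly_in_def)
  have var: "poly_in (Xv i)" if "i < 17" for i
    using that by (simp add: poly_in_def Xv_def)
  have diff: "poly_in (p - q)" if "poly_in p" "poly_in q" for p q
    using that keys_diff[of p q] by (auto simp: poly_in_def)
  have mult: "poly_in (p * q)" if "poly_in p" "poly_in q" for p q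
    unfolding poly_in_def
  proof
    fix m assume "m \<in> Poly_Mapping.keys (p * q)"
    then obtain a b where "m = a + b" "a \<in> Poly_Mapping.keys p" "b \<in> Poly_Mapping.keys q"
      using Poly_Mapping.keys_mult[of p q] by auto
    with that have "Poly_Mapping.keys a \<union> Poly_Mapping.keys b \<subseteq> {..<17}"
      by (simp add: poly_in_def)
    with \<open>m = a + b\<close> show "Poly_Mapping.keys m \<subseteq> {..<17}"
      using Poly_Mapping.keys_add[of a b] by blast
  qed
  have pow: "poly_in (p ^ k)" if "poly_in p" for p k
    by (induction k) (auto intro: one mult that)
  have "\<exists>p k. poly_in p \<and> x = Fract p (Xv 12 ^ k)"
    using assms
  proof induction
    case localised_one
    show ?case by (intro exI[of _ 1] exI[of _ 0]) (simp add: one One_fract_def)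
  next
    case (localised_var i)
    then show ?case by (intro exI[of _ "Xv i"] exI[of _ 0]) (simp add: var Xf_def)
  next
    case localised_inverse
    show ?case by (intro exI[of _ 1] exI[of _ 1]) (simp add: one Xf_def)
  next
    case (localised_diff x y)
    then obtain p k p' k' where "poly_in p" "x = Fract p (Xv 12 ^ k)"
      "poly_in p'" "y = Fract p' (Xv 12 ^ k')"
      by blast
    then show ?case
      by (intro exI[of _ "p * Xv 12 ^ k' - p' * Xv 12 ^ k"] exI[of _ "k + k'"])
        (auto simp: Fract_diff_common simp del: diff_fract intro!: diff mult pow var)
  next
    case (localised_mult x y)
    then obtain p k p' k' where "poly_in p" "x = Fract p (Xv 12 ^ k)"
      "poly_in p'" "y = Fract p' (Xv 12 ^ k')"
      by blast
    then show ?case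
      by (intro exI[of _ "p * p'"] exI[of _ "k + k'"]) (auto simp: power_add intro!: mult)
  qed
  then show ?thesis
    by (simp add: in_Rhat_def poly_in_def)
qed

subsection \<open>Coprimality without unique factorisation\<close>

lemma localised_poly:
  assumes "\<And>i. coeff P i \<in> localised S" "x \<in> localised S"
  shows "poly P x \<in> localised S"
  unfolding poly_altdef by (intro localised_sum localised_mult localised_power assms)

text \<open>Elements are viewed as polynomials in \<open>Xf j\<close>. The polynomials have
  coefficients in the fraction field, so that degree theory over a field is at hand; that the
  coefficients lie in the smaller ring is a side condition.\<close>

lemma localised_expand:
  assumes "x \<in> localised S"
  obtains P where "\<And>i. coeff P i \<in> localised (S - {j})" "x = poly P (Xf j)"
proof -
  from assms have "\<exists>P. (\<forall>i. coeff P i \<in> localised (S - {j})) \<and> x = poly P (Xf j)"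
  proof induction
    case localised_one
    show ?case by (intro exI[of _ 1]) (auto simp: localised_zero localised.localised_one)
  next
    case (localised_var i)
    show ?case
    proof (cases "i = j")
      case True
      then show ?thesis
        by (intro exI[of _ "[:0, 1:]"])
          (auto simp: localised_zero localised.localised_one coeff_pCons split: nat.splits)
    next
      case False
      with localised_var show ?thesis
        by (intro exI[of _ "[:Xf i:]"])
          (auto simp: localised_zero localised.localised_var coeff_pCons split: nat.splits)
    qed
  next
    case localised_inverse
    show ?case
      by (intro exI[of _ "[:inverse (Xf 12):]"])
        (auto simp: localised_zero localised.localised_inverse coeff_pCons split: nat.splits)
  next
    case (localised_diff x y)
    then obtain P Q where "\<And>i. coeff P i \<in> localised (S - {j})" "x = poly P (Xf j)"
      "\<And>i. coeff Q i \<in> localised (S - {j})" "y = poly Q (Xf j)"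
      by blast
    then show ?case
      by (intro exI[of _ "P - Q"]) (auto intro: localised.localised_diff)
  next
    case (localised_mult x y)
    then obtain P Q where "\<And>i. coeff P i \<in> localised (S - {j})" "x = poly P (Xf j)"
      "\<And>i. coeff Q i \<in> localised (S - {j})" "y = poly Q (Xf j)"
      by blast
    then show ?case
      by (intro exI[of _ "P * Q"]) (auto simp: coeff_mult intro!: localised_sum localised.localised_mult)
  qed
  then show ?thesis using that by blast
qed

text \<open>If \<open>Xf j\<close> is a root, then replacing it by any \<open>c\<close> shows that
  \<open>c\<close> is a root as well. A nonzero polynomial has finitely many roots, while the field
  contains the infinitely many \<open>Xf i\<close>.\<close>

lemma Xf_transcendental:
  assumes coeffs: "\<And>i. coeff P i \<in> localised (S - {j})"
    and S: "S \<subseteq> {..<17}" "j \<in> S" "j \<noteq> 12" and zero: "poly P (Xf j) = 0"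
  shows "P = 0"
proof (rule ccontr)
  assume "P \<noteq> 0"
  have "poly P c = 0" for c
  proof -
    define d where "d = Xf(j := c)"
    have d: "d j = c" "d 12 \<noteq> 0" using S by (auto simp: d_def)
    have var: "substitutes d (Xf j) c"
      using substitutes_var[of j d] S d(1) by auto
    have self: "substitutes d (coeff P i) (coeff P i)" for i
      by (rule substitutes_self[OF coeffs]) (use S in \<open>auto simp: d_def\<close>)
    have "substitutes d (poly Q (Xf j)) (poly Q c)" if "\<And>i. substitutes d (coeff Q i) (coeff Q i)" for Q
      using that
    proof (induction Q)
      case 0
      show ?case by (simp add: substitutes_zero)
    next
      case (pCons a Q)
      have "substitutes d a a" using pCons.prems[of 0] by simp
      moreover have "substitutes d (poly Q (Xf j)) (poly Q c)"
        using pCons.prems[of "Suc _"] by (intro pCons.IH) simp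
      ultimately show ?case by (simp add: substitutes_add substitutes_mult var)
    qed
    from this[OF self] zero have "substitutes d 0 (poly P c)" by simp
    from substitutes_unique[OF this substitutes_zero d(2)] show ?thesis .
  qed
  then have "finite (UNIV :: mpoly fract set)"
    using poly_roots_finite[OF \<open>P \<noteq> 0\<close>] by simp
  then show False
    using inj_Xf finite_imageD[of Xf UNIV] finite_subset[of "range Xf" UNIV] by auto
qed

text \<open>For \<open>p\<close> and \<open>q\<close> in the ring: multiplication by
  \<open>p\<close> is injective modulo \<open>q\<close>. This replaces a gcd condition and needs no
  factorisation theory, but symmetry becomes a lemma that requires \<open>q\<close> to be
  nonzero.\<close>

definition coprime_in :: "nat set \<Rightarrow> mpoly fract \<Rightarrow> mpoly fract \<Rightarrow> bool" where
  "coprime_in S p q \<longleftrightarrow>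
     (\<forall>x\<in>localised S. \<forall>y\<in>localised S. p * x = q * y \<longrightarrow> (\<exists>w\<in>localised S. x = q * w))"

lemma coprime_inD:
  assumes "coprime_in S p q" "x \<in> localised S" "y \<in> localised S" "p * x = q * y"
  obtains w where "w \<in> localised S" "x = q * w" 
  using assms unfolding coprime_in_def by blast

lemma coprime_in_one: "coprime_in S p 1"
  by (simp add: coprime_in_def)

lemma coprime_in_sym:
  assumes "coprime_in S p q" "q \<noteq> 0"
  shows "coprime_in S q p"
  unfolding coprime_in_def
proof (intro ballI impI)
  fix x y assume xy: "x \<in> localised S" "y \<in> localised S" "q * x = p * y"
  obtain w where "w \<in> localised S" "y = q * w"
    by (rule coprime_inD[OF assms(1) xy(2,1) xy(3)[symmetric]])
  with xy(3) assms(2) show "\<exists>w\<in>localised S. x = p * w"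
    by (intro bexI[of _ w]) auto
qed

lemma coprime_in_mult_right:
  assumes "coprime_in S p q" "coprime_in S p q'" "q \<in> localised S" "q' \<in> localised S" "q \<noteq> 0"
  shows "coprime_in S p (q * q')"
  unfolding coprime_in_def
proof (intro ballI impI)
  fix x y assume xy: "x \<in> localised S" "y \<in> localised S" "p * x = q * q' * y"
  obtain w where w: "w \<in> localised S" "x = q * w"
    by (rule coprime_inD[OF assms(1) xy(1), of "q' * y"]) (use xy assms in \<open>auto intro: localised_mult\<close>)
  with xy assms have "p * w = q' * y" by (simp add: algebra_simps)
  with assms w xy obtain w' where "w' \<in> localised S" "w = q' * w'"
    using coprime_inD by blast
  with w show "\<exists>w\<in>localised S. x = q * q' * w" by auto
qed

lemma coprime_in_power_right:
  assumes "coprime_in S p q" "q \<in> localised S" "q \<noteq> 0"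
  shows "coprime_in S p (q ^ k)"
  by (induction k)
    (use assms in \<open>auto intro!: coprime_in_one coprime_in_mult_right localised_power\<close>)

lemma coprime_in_powers:
  assumes "coprime_in S p q" "p \<in> localised S" "q \<in> localised S" "p \<noteq> 0" "q \<noteq> 0"
  shows "coprime_in S (p ^ k) (q ^ l)"
  using assms by (meson coprime_in_power_right coprime_in_sym power_not_zero)

text \<open>If \<open>x = q * w\<close> with \<open>x\<close> and \<open>q\<close> free of
  \<open>Xf j\<close>, comparing constant coefficients in \<open>Xf j\<close> shows that
  \<open>w\<close> may be replaced by its constant coefficient.\<close>

lemma coprime_in_restrict:
  assumes "coprime_in S p q" "p \<in> localised (S - {j})" "q \<in> localised (S - {j})"
    and S: "S \<subseteq> {..<17}" "j \<in> S" "j \<noteq> 12"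
  shows "coprime_in (S - {j}) p q"
  unfolding coprime_in_def
proof (intro ballI impI)
  fix x y assume x: "x \<in> localised (S - {j})" and y: "y \<in> localised (S - {j})" and eq: "p * x = q * y"
  have mono: "z \<in> localised S" if "z \<in> localised (S - {j})" for z
    using that by (rule localised_mono) auto
  obtain w where "w \<in> localised S" and xw: "x = q * w"
    using coprime_inD[OF assms(1) mono[OF x] mono[OF y] eq] .
  then obtain W where W: "\<And>i. coeff W i \<in> localised (S - {j})" "w = poly W (Xf j)"
    using localised_expand by blast
  have "[:x:] - smult q W = 0"
  proof (rule Xf_transcendental[OF _ S])
    show "coeff ([:x:] - smult q W) i \<in> localised (S - {j})" for i
      using x W(1) assms(3) by (auto simp: coeff_pCons intro!: localised_intros split: nat.splits)
  qed (simp add: xw W(2))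
  then have "x = q * coeff W 0"
    by (metis coeff_pCons_0 coeff_smult eq_iff_diff_eq_0)
  with W(1) show "\<exists>w\<in>localised (S - {j}). x = q * w" by blast
qed

text \<open>A Gauss-type argument: if \<open>p\<close> divides a multiple of a linear polynomial
  whose leading coefficient is coprime to \<open>p\<close>, it divides the coefficients of the
  cofactor one by one from the top. Coprimality of explicit polynomials is obtained below by
  choosing an indeterminate that occurs linearly.\<close>

lemma coprime_in_linear:
  assumes cop: "coprime_in S p u" and D: "p \<in> localised (S - {j})" "u \<in> localised (S - {j})" "v \<in> localised (S - {j})"
    and S: "S \<subseteq> {..<17}" "j \<in> S" "j \<noteq> 12" and nz: "p \<noteq> 0" "u \<noteq> 0"
  shows "coprime_in S p (u * Xf j + v)"
  unfolding coprime_in_def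
proof (intro ballI impI)
  let ?D = "localised (S - {j})"
  have cop': "coprime_in (S - {j}) p u"
    using coprime_in_restrict[OF cop D(1,2) S] .
  \<comment> \<open>Here \<open>n\<close> bounds the number of possibly nonzero coefficients of the
    cofactor \<open>B\<close>; the induction removes its top coefficient.\<close>
  have main: "\<exists>W. (\<forall>i. coeff W i \<in> ?D) \<and> B = smult p W"
    if "\<And>i. coeff A i \<in> ?D" "\<And>i. coeff B i \<in> ?D" "smult p A = [:v, u:] * B" "\<And>i. i \<ge> n \<Longrightarrow> coeff B i = 0"
    for n A B
    using that
  proof (induction n arbitrary: A B)
    case 0
    then have "B = 0" by (simp add: poly_eq_iff)
    then show ?case by (intro exI[of _ 0]) (simp add: localised_zero)
  next
    case (Suc n)
    have "coeff (smult p A) (Suc n) = coeff ([:v, u:] * B) (Suc n)"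
      using Suc.prems(3) by simp
    then have "p * coeff A (Suc n) = u * coeff B n"
      using Suc.prems(4)[of "Suc n"] by (simp add: coeff_pCons)
    then obtain e where e: "e \<in> ?D" "coeff A (Suc n) = u * e"
      using coprime_inD[OF cop'] Suc.prems(1,2) by metis
    with \<open>p * coeff A (Suc n) = u * coeff B n\<close> nz have be: "coeff B n = p * e" by simp
    \<comment> \<open>As \<open>coeff B n = p * e\<close>, the top term of \<open>B\<close> can be
      removed together with the matching multiple of the linear polynomial in \<open>A\<close>,
      preserving the equation.\<close>
    define A' B' where "A' = A - [:v, u:] * monom e n" and "B' = B - monom (p * e) n"
    have "\<exists>W. (\<forall>i. coeff W i \<in> ?D) \<and> B' = smult p W"
    proof (rule Suc.IH)
      show "coeff A' i \<in> ?D" for i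
        using Suc.prems(1)[of i] D e(1)
        by (auto simp: A'_def coeff_pCons intro!: localised_intros split: nat.splits)
      show "coeff B' i \<in> ?D" for i
        using Suc.prems(2)[of i] D e(1)
        by (auto simp: B'_def coeff_pCons intro!: localised_intros split: nat.splits)
      show "smult p A' = [:v, u:] * B'"
        unfolding A'_def B'_def
        by (simp only: smult_diff_right right_diff_distrib Suc.prems(3) mult_smult_right flip: smult_monom)
      show "coeff B' i = 0" if "i \<ge> n" for i
        using that be Suc.prems(4)[of i] by (cases "i = n") (auto simp: B'_def)
    qed
    then obtain W where W: "\<And>i. coeff W i \<in> ?D" "B' = smult p W" by blast
    show ?case
      by (intro exI[of _ "W + monom e n"] conjI allI)
        (use W e(1) in \<open>auto simp: B'_def smult_add_right smult_monom algebra_simps intro!: localised_intros\<close>)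
  qed
  fix x y assume xy: "x \<in> localised S" "y \<in> localised S" "p * x = (u * Xf j + v) * y"
  obtain A where A: "\<And>i. coeff A i \<in> ?D" "x = poly A (Xf j)"
    using localised_expand[OF xy(1)] by blast
  obtain B where B: "\<And>i. coeff B i \<in> ?D" "y = poly B (Xf j)"
    using localised_expand[OF xy(2)] by blast
  have "smult p A - [:v, u:] * B = 0"
  proof (rule Xf_transcendental[OF _ S])
    show "coeff (smult p A - [:v, u:] * B) i \<in> ?D" for i
      using A(1) B(1) D by (auto simp: coeff_pCons intro!: localised_intros split: nat.splits)
    show "poly (smult p A - [:v, u:] * B) (Xf j) = 0"
      using xy(3) A(2) B(2) by (simp add: algebra_simps)
  qed
  then have "\<exists>W. (\<forall>i. coeff W i \<in> ?D) \<and> B = smult p W"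
    by (intro main[of A B "Suc (degree B)"] A B) (auto intro: coeff_eq_0)
  then obtain W where W: "\<And>i. coeff W i \<in> ?D" "B = smult p W" by blast
  have "poly W (Xf j) \<in> localised S"
    using W(1) S by (intro localised_poly localised_var) (auto intro: localised_mono[of _ "S - {j}"])
  moreover have "p * x = p * ((u * Xf j + v) * poly W (Xf j))"
    unfolding xy(3) B(2) W(2) by simp
  then have "x = (u * Xf j + v) * poly W (Xf j)"
    using nz(1) by simp
  ultimately show "\<exists>w\<in>localised S. x = (u * Xf j + v) * w" by blast
qed

section \<open>Divisibility by a quadratic in one indeterminate\<close>

context
  fixes S :: "nat set" and j :: nat and q0 q1 q2 :: "mpoly fract"
  assumes S: "S \<subseteq> {..<17}" "j \<in> S" "j \<noteq> 12"
    and q: "q0 \<in> localised (S - {j})" "q1 \<in> localised (S - {j})" "q2 \<in> localised (S - {j})"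
begin

lemma subring_mono: "z \<in> localised (S - {j}) \<Longrightarrow> z \<in> localised S"
  by (rule localised_mono) auto

text \<open>The leading coefficient \<open>q2\<close> is not a unit, so division with remainder is
  possible only after multiplying by a power of it.\<close>

lemma quadratic_pseudo_divide:
  assumes "x \<in> localised S"
  obtains k g a b where "g \<in> localised S" "a \<in> localised (S - {j})" "b \<in> localised (S - {j})"
    "q2 ^ k * x = (q2 * Xf j ^ 2 + q1 * Xf j + q0) * g + (a * Xf j + b)"
proof -
  obtain P where P: "\<And>i. coeff P i \<in> localised (S - {j})" "x = poly P (Xf j)"
    using localised_expand[OF assms] by blast
  have "\<exists>k. \<exists>g\<in>localised S. \<exists>a\<in>localised (S - {j}). \<exists>b\<in>localised (S - {j}).
      q2 ^ k * poly P (Xf j) = (q2 * Xf j ^ 2 + q1 * Xf j + q0) * g + (a * Xf j + b)"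
    using P(1)
  proof (induction P)
    case 0
    show ?case by (auto intro!: exI bexI[of _ 0] localised_zero)
  next
    case (pCons c P)
    have c: "c \<in> localised (S - {j})" using pCons.prems[of 0] by simp
    obtain k g a b where IH: "g \<in> localised S" "a \<in> localised (S - {j})" "b \<in> localised (S - {j})"
      "q2 ^ k * poly P (Xf j) = (q2 * Xf j ^ 2 + q1 * Xf j + q0) * g + (a * Xf j + b)"
      using pCons.IH pCons.prems[of "Suc _"] by auto
    have "q2 ^ Suc k * poly (pCons c P) (Xf j) = q2 ^ Suc k * c + q2 * Xf j * (q2 ^ k * poly P (Xf j))"
      by (simp add: algebra_simps)
    \<comment> \<open>The new square term \<open>a * q2 * Xf j ^ 2\<close> is replaced by
      \<open>a\<close> times the quadratic minus \<open>a * (q1 * Xf j + q0)\<close>.\<close>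
    also have "\<dots> = (q2 * Xf j ^ 2 + q1 * Xf j + q0) * (q2 * Xf j * g + a)
        + ((q2 * b - a * q1) * Xf j + (q2 ^ Suc k * c - a * q0))"
      unfolding IH(4) by (simp add: algebra_simps power2_eq_square)
    finally have "q2 ^ Suc k * poly (pCons c P) (Xf j) = \<dots>" .
    moreover have "q2 * Xf j * g + a \<in> localised S"
      by (intro localised_intros subring_mono[OF q(3)] S IH(1) subring_mono[OF IH(2)])
    moreover have "q2 * b - a * q1 \<in> localised (S - {j})" "q2 ^ Suc k * c - a * q0 \<in> localised (S - {j})"
      by (intro localised_intros q c IH)+
    ultimately show ?case by blast
  qed
  with P(2) that show ?thesis by blast
qed

lemma quadratic_multiple_linear:
  assumes "q2 \<noteq> 0" "g \<in> localised S" "a \<in> localised (S - {j})" "b \<in> localised (S - {j})"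
    and eq: "(q2 * Xf j ^ 2 + q1 * Xf j + q0) * g = a * Xf j + b"
  shows "g = 0"
proof -
  obtain G where G: "\<And>i. coeff G i \<in> localised (S - {j})" "g = poly G (Xf j)"
    using localised_expand[OF assms(2)] by blast
  have "[:q0, q1, q2:] * G - [:b, a:] = 0"
  proof (rule Xf_transcendental[OF _ S])
    show "coeff ([:q0, q1, q2:] * G - [:b, a:]) i \<in> localised (S - {j})" for i
      using G(1) q assms(3,4) by (auto simp: coeff_pCons intro!: localised_intros split: nat.splits)
    show "poly ([:q0, q1, q2:] * G - [:b, a:]) (Xf j) = 0"
      using eq G(2) by (simp add: algebra_simps power2_eq_square)
  qed
  then have "degree ([:q0, q1, q2:] * G) \<le> 1"
    by (simp only: eq_iff_diff_eq_0[symmetric]) (simp add: degree_pCons_le)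
  then have "G = 0"
    using assms(1) by (cases "G = 0") (auto simp: degree_mult_eq simp del: mult_pCons_left)
  with G(2) show ?thesis by simp
qed

text \<open>The remainder \<open>a X + b\<close> of \<open>c\<close> modulo the quadratic has norm
  \<open>q2 b\<^sup>2 - q1 a b + q0 a\<^sup>2\<close>; at a specialisation where the quadratic becomes \<open>q2 X\<^sup>2\<close>,
  this norm does not vanish as soon as \<open>c\<close> does not vanish at \<open>X = 0\<close>.\<close>
lemma quadratic_cancel:
  fixes d :: "nat \<Rightarrow> 'a::field"
  assumes mem: "c \<in> localised S" "x \<in> localised S" "y \<in> localised S"
    and eq: "c * x = (q2 * Xf j ^ 2 + q1 * Xf j + q0) * y"
    and d: "d 12 \<noteq> 0" "d j = 0" "substitutes d q2 e2" "substitutes d q1 0" "substitutes d q0 0"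
      "substitutes d c e" "e2 \<noteq> 0" "e \<noteq> 0"
  obtains k g where "g \<in> localised S" "q2 ^ k * x = (q2 * Xf j ^ 2 + q1 * Xf j + q0) * g"
proof -
  define Q where "Q = q2 * Xf j ^ 2 + q1 * Xf j + q0"
  have X: "Xf j \<in> localised S" using S by (simp add: localised_var)
  have subst_ex: "\<exists>y. substitutes d z y" if "z \<in> localised S" for z
    using substitutes_exists[OF localised_mono[OF that S(1)], of d] by blast
  have q2: "q2 \<noteq> 0"
    using substitutes_unique[OF d(3) _ d(1)] substitutes_zero d(7) by blast
  obtain k g a b where g: "g \<in> localised S" and a: "a \<in> localised (S - {j})" and b: "b \<in> localised (S - {j})"
    and division: "q2 ^ k * c = Q * g + (a * Xf j + b)"
    by (rule quadratic_pseudo_divide[OF mem(1), folded Q_def])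
  define \<rho> where "\<rho> = q2 * b ^ 2 - q1 * a * b + q0 * a ^ 2"
  have \<rho>: "\<rho> \<in> localised (S - {j})" unfolding \<rho>_def by (intro localised_intros q a b)
  have "\<rho> \<noteq> 0"
  proof
    assume "\<rho> = 0"
    obtain a' b' g' where sub: "substitutes d a a'" "substitutes d b b'" "substitutes d g g'"
      using subst_ex a b g subring_mono by meson
    have X0: "substitutes d (Xf j) 0"
      using substitutes_var[of j d] d(2) S by auto
    have "substitutes d (q2 ^ k * c) ((e2 * 0 ^ 2 + 0 * 0 + 0) * g' + (a' * 0 + b'))"
      unfolding division Q_def by (intro substitutes_intros sub X0 d)
    moreover have "substitutes d (q2 ^ k * c) (e2 ^ k * e)"
      by (intro substitutes_intros d)
    ultimately have "e2 ^ k * e = (e2 * 0 ^ 2 + 0 * 0 + 0) * g' + (a' * 0 + b')"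
      using substitutes_unique d(1) by blast
    then have "b' = e2 ^ k * e" by simp
    then have "b' \<noteq> 0" using d(7,8) by simp
    have "substitutes d \<rho> (e2 * b' ^ 2 - 0 * a' * b' + 0 * a' ^ 2)"
      unfolding \<rho>_def by (intro substitutes_intros sub d)
    then have "substitutes d 0 (e2 * b' ^ 2)"
      using \<open>\<rho> = 0\<close> by simp
    then have "e2 * b' ^ 2 = 0"
      using substitutes_unique substitutes_zero d(1) by blast
    with \<open>b' \<noteq> 0\<close> d(7) show False by simp
  qed
  define z where "z = (q2 * (b - a * Xf j) - q1 * a) * (q2 ^ k * y - g * x) - a ^ 2 * (- x)"
  \<comment> \<open>The factor \<open>q2 * (b - a * Xf j) - q1 * a\<close> is the conjugate of the
    remainder \<open>a * Xf j + b\<close>, scaled by \<open>q2\<close>; their product is the norm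
    \<open>\<rho>\<close> modulo \<open>Q\<close>.\<close>
  have "\<rho> * x = (q2 * (b - a * Xf j) - q1 * a) * ((a * Xf j + b) * x) + Q * (a ^ 2 * x)"
    unfolding \<rho>_def Q_def by (simp add: algebra_simps power2_eq_square)
  also have "(a * Xf j + b) * x = Q * (q2 ^ k * y - g * x)"
  proof -
    have *: "a * Xf j + b = q2 ^ k * c - Q * g"
      using division by simp
    have "(a * Xf j + b) * x = q2 ^ k * (c * x) - Q * g * x"
      unfolding * by (simp add: algebra_simps)
    then show ?thesis unfolding eq Q_def[symmetric] by (simp add: algebra_simps)
  qed
  finally have norm: "\<rho> * x = Q * z"
    unfolding z_def by (simp add: algebra_simps)
  have z: "z \<in> localised S"
    unfolding z_def by (intro localised_intros X mem g subring_mono[OF a] subring_mono[OF b]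
        subring_mono[OF q(1)] subring_mono[OF q(2)] subring_mono[OF q(3)])
  \<comment> \<open>Now \<open>x\<close> itself is divided by \<open>Q\<close>. Since
    \<open>\<rho>\<close> is free of \<open>Xf j\<close>, \<open>\<rho>\<close> times the new
    remainder is a multiple of \<open>Q\<close> of degree at most 1, hence zero.\<close>
  obtain l h a' b' where h: "h \<in> localised S" and a': "a' \<in> localised (S - {j})" and b': "b' \<in> localised (S - {j})"
    and division': "q2 ^ l * x = Q * h + (a' * Xf j + b')"
    by (rule quadratic_pseudo_divide[OF mem(2), folded Q_def])
  have rem: "Q * (q2 ^ l * z - \<rho> * h) = \<rho> * a' * Xf j + \<rho> * b'"
  proof -
    have "Q * (q2 ^ l * z - \<rho> * h) = q2 ^ l * (Q * z) - \<rho> * (Q * h)" by (simp add: algebra_simps)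
    also have "\<dots> = \<rho> * (q2 ^ l * x - Q * h)" unfolding norm[symmetric] by (simp add: algebra_simps)
    also have "\<dots> = \<rho> * (a' * Xf j + b')" unfolding division' by simp
    finally show ?thesis by (simp add: algebra_simps)
  qed
  have "q2 ^ l * z - \<rho> * h = 0"
    by (rule quadratic_multiple_linear[OF q2 _ _ _ rem[unfolded Q_def]])
      (intro localised_intros z h subring_mono[OF \<rho>] subring_mono[OF q(3)] \<rho> a' b')+
  with rem \<open>\<rho> \<noteq> 0\<close> have "a' * Xf j + b' = 0"
    by (simp add: algebra_simps flip: distrib_left)
  with division' h that show ?thesis unfolding Q_def by auto
qed

end

subsection \<open>Orbits\<close>

definition matA :: "(nat \<Rightarrow> 'a) \<Rightarrow> nat \<Rightarrow> nat \<Rightarrow> 'a" where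
  "matA d i j = d (symidx i j)"

definition matB :: "(nat \<Rightarrow> 'a) \<Rightarrow> nat \<Rightarrow> nat \<Rightarrow> 'a" where
  "matB d i j = d (6 + symidx i j)"

text \<open>One assignment supplies both the matrices and the initial values, so
  \<open>orbit Xf\<close> is the generic orbit and specialising it amounts to changing the
  argument.\<close>

definition orbit :: "(nat \<Rightarrow> 'a::field) \<Rightarrow> nat \<Rightarrow> 'a \<times> 'a \<times> 'a" where
  "orbit d = qrt (matA d) (matB d) (d 12) (d 13) (d 14) (d 15) (d 16)"

definition orbit_r :: "(nat \<Rightarrow> 'a::field) \<Rightarrow> nat \<Rightarrow> 'a" where "orbit_r d n = fst (orbit d n)"
definition orbit_s :: "(nat \<Rightarrow> 'a::field) \<Rightarrow> nat \<Rightarrow> 'a" where "orbit_s d n = fst (snd (orbit d n))"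
definition orbit_t :: "(nat \<Rightarrow> 'a::field) \<Rightarrow> nat \<Rightarrow> 'a" where "orbit_t d n = snd (snd (orbit d n))"

abbreviation rowA :: "(nat \<Rightarrow> 'a::comm_ring_1) \<Rightarrow> 'a \<Rightarrow> 'a \<Rightarrow> nat \<Rightarrow> 'a" where
  "rowA d s t \<equiv> matvec (matA d) (Vv s t)"

abbreviation rowB :: "(nat \<Rightarrow> 'a::comm_ring_1) \<Rightarrow> 'a \<Rightarrow> 'a \<Rightarrow> nat \<Rightarrow> 'a" where
  "rowB d s t \<equiv> matvec (matB d) (Vv s t)"

abbreviation FFd :: "(nat \<Rightarrow> 'a::comm_ring_1) \<Rightarrow> 'a \<Rightarrow> 'a \<Rightarrow> nat \<Rightarrow> 'a" where
  "FFd d \<equiv> FF (matA d) (matB d)"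

abbreviation QQd :: "(nat \<Rightarrow> 'a::comm_ring_1) \<Rightarrow> 'a \<Rightarrow> 'a \<Rightarrow> 'a" where
  "QQd d \<equiv> QQ (matA d) (matB d)"

lemma symidx_simps:
  "symidx 0 0 = 0" "symidx 0 1 = 1" "symidx 0 2 = 2" "symidx 1 0 = 1" "symidx 1 1 = 3"
  "symidx 1 2 = 4" "symidx 2 0 = 2" "symidx 2 1 = 4" "symidx 2 2 = 5"
  by (simp_all add: symidx_def)

lemma sum_lessThan_3: "(\<Sum>i<3. f i) = f 0 + f 1 + f (2::nat)"
  by (simp add: numeral_3_eq_3 numeral_2_eq_2)

lemma row_simps:
  "rowA d s t 0 = d 0 * s ^ 2 + d 1 * (s * t) + d 2 * t ^ 2"
  "rowA d s t 1 = d 1 * s ^ 2 + d 3 * (s * t) + d 4 * t ^ 2"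
  "rowA d s t 2 = d 2 * s ^ 2 + d 4 * (s * t) + d 5 * t ^ 2"
  "rowB d s t 0 = d 6 * s ^ 2 + d 7 * (s * t) + d 8 * t ^ 2"
  "rowB d s t 1 = d 7 * s ^ 2 + d 9 * (s * t) + d 10 * t ^ 2"
  "rowB d s t 2 = d 8 * s ^ 2 + d 10 * (s * t) + d 11 * t ^ 2"
  unfolding matvec_def matA_def matB_def Vv_def sum_lessThan_3
  by (simp_all add: symidx_simps del: One_nat_def)

lemma FF_simps:
  "FFd d s t 0 = rowA d s t 1 * rowB d s t 2 - rowA d s t 2 * rowB d s t 1"
  "FFd d s t 1 = rowA d s t 2 * rowB d s t 0 - rowA d s t 0 * rowB d s t 2"
  "FFd d s t 2 = rowA d s t 0 * rowB d s t 1 - rowA d s t 1 * rowB d s t 0"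
  by (simp_all add: FF_def cross3_def)

lemma orbit_initial:
  "orbit_r d 0 = d 12" "orbit_s d 0 = d 13" "orbit_t d 0 = d 15"
  "orbit_s d (Suc 0) = d 14" "orbit_t d (Suc 0) = d 16"
  by (simp_all add: orbit_r_def orbit_s_def orbit_t_def orbit_def)

lemma orbit_r_Suc:
  "orbit_r d (Suc n) = QQd d (orbit_s d (Suc n)) (orbit_t d (Suc n)) / orbit_r d n"
  by (cases n) (simp_all add: orbit_r_def orbit_s_def orbit_t_def orbit_def Let_def case_prod_unfold)

lemma orbit_s_Suc_Suc:
  "orbit_s d (Suc (Suc n)) =
    (orbit_t d n * FFd d (orbit_s d (Suc n)) (orbit_t d (Suc n)) 0
      - orbit_s d n * FFd d (orbit_s d (Suc n)) (orbit_t d (Suc n)) 1) / orbit_r d n"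
  by (simp add: orbit_r_def orbit_s_def orbit_t_def orbit_def Let_def case_prod_unfold)

lemma orbit_t_Suc_Suc:
  "orbit_t d (Suc (Suc n)) =
    (orbit_t d n * FFd d (orbit_s d (Suc n)) (orbit_t d (Suc n)) 1
      - orbit_s d n * FFd d (orbit_s d (Suc n)) (orbit_t d (Suc n)) 2) / orbit_r d n"
  by (simp add: orbit_r_def orbit_s_def orbit_t_def orbit_def Let_def case_prod_unfold)

lemmas orbit_steps = orbit_r_Suc orbit_s_Suc_Suc orbit_t_Suc_Suc

text \<open>Data for restarting at time \<open>m\<close>: same matrices, initial values taken from
  times \<open>m\<close> and \<open>Suc m\<close>. No entry holds \<open>r (Suc m)\<close>, which
  the recursion recomputes from the others.\<close>

definition shift_data :: "nat \<Rightarrow> (nat \<Rightarrow> 'a::field) \<Rightarrow> nat \<Rightarrow> 'a" where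
  "shift_data m d = d(12 := orbit_r d m, 13 := orbit_s d m, 14 := orbit_s d (Suc m),
     15 := orbit_t d m, 16 := orbit_t d (Suc m))"

lemma shift_data_mat:
  assumes "i < 3" "j < 3"
  shows "matA (shift_data m d) i j = matA d i j" "matB (shift_data m d) i j = matB d i j"
proof -
  have "symidx i j < 6"
    using assms by (auto simp: symidx_def numeral_3_eq_3 less_Suc_eq)
  then show "matA (shift_data m d) i j = matA d i j" "matB (shift_data m d) i j = matB d i j"
    by (auto simp: matA_def matB_def shift_data_def)
qed

lemma shift_data_row:
  assumes "i < 3"
  shows "rowA (shift_data m d) s t i = rowA d s t i" "rowB (shift_data m d) s t i = rowB d s t i"
  using assms by (auto simp: matvec_def shift_data_mat)

lemma shift_data_FF: "FFd (shift_data m d) s t i = FFd d s t i"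
  by (simp add: FF_def cross3_def shift_data_row)

lemma shift_data_QQ: "QQd (shift_data m d) s t = QQd d s t"
  by (simp add: QQ_def shift_data_FF)

lemma orbit_shift:
  "orbit_r (shift_data m d) n = orbit_r d (m + n) \<and> orbit_s (shift_data m d) n = orbit_s d (m + n) \<and>
   orbit_t (shift_data m d) n = orbit_t d (m + n)"
proof (induction n rule: less_induct)
  case (less n)
  consider "n = 0" | "n = 1" | k where "n = Suc (Suc k)"
    by (metis One_nat_def not0_implies_Suc)
  then show ?case
  proof cases
    case 1
    then show ?thesis by (simp add: orbit_initial) (simp add: shift_data_def)
  next
    case 2
    then show ?thesis
      by (simp add: orbit_initial orbit_r_Suc shift_data_QQ) (simp add: shift_data_def)
  next
    case 3
    with less[of k] less[of "Suc k"] show ?thesis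
      by (simp add: orbit_steps shift_data_QQ shift_data_FF)
  qed
qed

section \<open>Generic orbits under specialisation\<close>

lemma substitutes_FF:
  assumes "substitutes d s s'" "substitutes d t t'"
  shows "substitutes d (FFd Xf s t i) (FFd d s' t' i)"
  unfolding FF_def cross3_def row_simps by (auto intro!: substitutes_intros assms)

lemma substitutes_QQ:
  assumes "substitutes d s s'" "substitutes d t t'"
  shows "substitutes d (QQd Xf s t) (QQd d s' t')"
  unfolding QQ_def by (intro substitutes_intros substitutes_FF assms)

lemma localised_FF:
  assumes "s \<in> laurent_ring" "t \<in> laurent_ring"
  shows "FFd Xf s t i \<in> laurent_ring"
  unfolding FF_def cross3_def row_simps by (auto intro!: localised_intros assms)

lemma localised_QQ:
  assumes "s \<in> laurent_ring" "t \<in> laurent_ring"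
  shows "QQd Xf s t \<in> laurent_ring"
  unfolding QQ_def by (intro localised_intros localised_FF assms)

text \<open>The substitution has no rule for quotients. If the quotient is known to be a Laurent
  polynomial, its value is found by multiplying back with the denominator.\<close>

lemma substitutes_divide:
  assumes "substitutes d x x'" "substitutes d y y'" "x / y \<in> laurent_ring"
    "y \<noteq> 0" "y' \<noteq> 0" "d 12 \<noteq> 0"
  shows "substitutes d (x / y) (x' / y')"
proof -
  obtain z where z: "substitutes d (x / y) z"
    using substitutes_exists[OF assms(3)] .
  have "substitutes d (x / y * y) (z * y')"
    by (intro substitutes_mult z assms)
  then have "z * y' = x'"
    using assms by (auto intro: substitutes_unique)
  then have "z = x' / y'" using assms(5) by (simp add: field_simps)
  with z show ?thesis by simp
qed

definition laurent_at :: "nat \<Rightarrow> bool" where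
  "laurent_at n \<longleftrightarrow> orbit_r Xf n \<in> laurent_ring \<and> orbit_s Xf n \<in> laurent_ring \<and>
     orbit_t Xf n \<in> laurent_ring"

text \<open>Specialising the generic orbit commutes with iterating as long as the iterates are
  Laurent, so that they can be specialised at all, and no divisor \<open>r i\<close> vanishes on
  either side.\<close>

lemma substitutes_orbit:
  assumes "\<And>i. i \<le> n \<Longrightarrow> laurent_at i" "\<And>i. i < n \<Longrightarrow> orbit_r Xf i \<noteq> 0"
    "\<And>i. i < n \<Longrightarrow> orbit_r d i \<noteq> 0" "d 12 \<noteq> 0"
  shows "substitutes d (orbit_r Xf n) (orbit_r d n) \<and> substitutes d (orbit_s Xf n) (orbit_s d n) \<and>
    substitutes d (orbit_t Xf n) (orbit_t d n)"
  using assms(1-3)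
proof (induction n rule: less_induct)
  case (less n)
  have prev: "substitutes d (orbit_r Xf k) (orbit_r d k)" "substitutes d (orbit_s Xf k) (orbit_s d k)"
    "substitutes d (orbit_t Xf k) (orbit_t d k)" if "k < n" for k
    using less.IH[OF that] less.prems that by auto
  consider "n = 0" | "n = 1" | k where "n = Suc (Suc k)"
    by (metis One_nat_def not0_implies_Suc)
  then have st: "substitutes d (orbit_s Xf n) (orbit_s d n) \<and> substitutes d (orbit_t Xf n) (orbit_t d n)"
  proof cases
    case 3
    have mem: "orbit_s Xf (Suc (Suc k)) \<in> laurent_ring" "orbit_t Xf (Suc (Suc k)) \<in> laurent_ring"
      using less.prems(1)[of n] 3 by (auto simp: laurent_at_def)
    show ?thesis unfolding 3 orbit_steps
      using 3 less.prems(2,3) prev mem[unfolded orbit_steps]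
      by (intro conjI substitutes_divide substitutes_diff substitutes_mult substitutes_FF assms(4)) auto
  qed (auto simp: orbit_initial intro: substitutes_var)
  show ?case
  proof (cases n)
    case 0
    with st show ?thesis by (simp add: orbit_initial substitutes_var)
  next
    case (Suc k)
    have mem: "orbit_r Xf (Suc k) \<in> laurent_ring"
      using less.prems(1)[of n] Suc by (auto simp: laurent_at_def)
    have "substitutes d (orbit_r Xf n) (orbit_r d n)"
      unfolding Suc orbit_r_Suc using st Suc less.prems(2,3) prev mem[unfolded orbit_r_Suc]
      by (intro substitutes_divide substitutes_QQ assms(4)) auto
    with st show ?thesis by simp
  qed
qed

lemma orbit_r_nonzero:
  assumes "\<And>i. i \<le> n \<Longrightarrow> laurent_at i"
  shows "orbit_r Xf n \<noteq> 0"
  using assms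
proof (induction n rule: less_induct)
  case (less n)
  \<comment> \<open>This is \<open>A = diag(1,0,1)\<close>, \<open>B = diag(0,1,0)\<close> with all
    initial values 1. Along this orbit \<open>v (n + 2) = - v n\<close> and \<open>r\<close> is
    constantly 1, so no \<open>r n\<close> can vanish generically.\<close>
  define d :: "nat \<Rightarrow> rat" where "d i = (if i \<in> {0, 5, 9, 12, 13, 14, 15, 16} then 1 else 0)" for i
  define good where "good i \<longleftrightarrow> orbit_r d i = 1 \<and> (orbit_s d i = 1 \<or> orbit_s d i = -1) \<and>
      orbit_t d i = orbit_s d i" for i
  have "good i \<and> good (Suc i)" for i
  proof (induction i)
    case 0
    show ?case
      by (simp add: good_def orbit_initial orbit_r_Suc QQ_def FF_simps row_simps del: One_nat_def)
        (simp add: d_def)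
  next
    case (Suc i)
    have row: "rowA d x x 0 = x ^ 2" "rowA d x x 1 = 0" "rowA d x x 2 = x ^ 2"
      "rowB d x x 0 = 0" "rowB d x x 1 = x ^ 2" "rowB d x x 2 = 0" for x
      unfolding row_simps by (simp_all add: d_def power2_eq_square)
    from Suc have s: "orbit_s d (Suc (Suc i)) = - orbit_s d i" "orbit_t d (Suc (Suc i)) = - orbit_s d i"
      by (auto simp: good_def orbit_s_Suc_Suc orbit_t_Suc_Suc FF_simps row simp del: One_nat_def)
    have "orbit_r d (Suc (Suc i)) = 1"
      unfolding orbit_r_Suc[of d "Suc i"] s using Suc by (auto simp: good_def QQ_def FF_simps row simp del: One_nat_def)
    with s Suc show ?case by (auto simp: good_def)
  qed
  then have d: "orbit_r d i = 1" for i by (simp add: good_def)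
  have "substitutes d (orbit_r Xf n) (orbit_r d n)"
    using substitutes_orbit[of n d] less d orbit_initial(1)[of d] by fastforce
  with d[of n] show ?case
    using substitutes_unique[OF _ substitutes_zero, of d] d[of 0] orbit_initial(1)[of d] by fastforce
qed

subsection \<open>The first iterates\<close>

text \<open>The trace-free map sending \<open>(x, y)\<close> to \<open>(x', y')\<close> has
  determinant \<open>f0 * f2 - f1 ^ 2\<close>, and it scales both binary quadratic forms
  \<open>a\<close> and \<open>b\<close> by minus this determinant. It is the QRT involution in
  homogeneous coordinates.\<close>

lemma involution_form:
  fixes a0 a1 a2 b0 b1 b2 x y :: "'a::comm_ring_1"
  defines "f0 \<equiv> a1 * b2 - a2 * b1" and "f1 \<equiv> a2 * b0 - a0 * b2" and "f2 \<equiv> a0 * b1 - a1 * b0"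
  defines "x' \<equiv> y * f0 - x * f1" and "y' \<equiv> y * f1 - x * f2"
  shows "a0 * x' ^ 2 + a1 * (x' * y') + a2 * y' ^ 2 = (f1 ^ 2 - f0 * f2) * (a0 * x ^ 2 + a1 * (x * y) + a2 * y ^ 2)"
    and "b0 * x' ^ 2 + b1 * (x' * y') + b2 * y' ^ 2 = (f1 ^ 2 - f0 * f2) * (b0 * x ^ 2 + b1 * (x * y) + b2 * y ^ 2)"
  unfolding x'_def y'_def f0_def f1_def f2_def by (simp_all add: algebra_simps power2_eq_square)

text \<open>Vieta's formulas: \<open>(x, y)\<close> and \<open>(x', y')\<close> are the two
  projective roots of the pencil member \<open>h * b - k * a\<close>, which vanishes at
  \<open>(x, y)\<close> by the choice of \<open>h\<close> and \<open>k\<close>.\<close>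

lemma involution_products:
  fixes a0 a1 a2 b0 b1 b2 x y :: "'a::comm_ring_1"
  defines "f0 \<equiv> a1 * b2 - a2 * b1" and "f1 \<equiv> a2 * b0 - a0 * b2" and "f2 \<equiv> a0 * b1 - a1 * b0"
  defines "x' \<equiv> y * f0 - x * f1" and "y' \<equiv> y * f1 - x * f2"
  defines "h \<equiv> a0 * x ^ 2 + a1 * (x * y) + a2 * y ^ 2" and "k \<equiv> b0 * x ^ 2 + b1 * (x * y) + b2 * y ^ 2"
  shows "x * x' = h * b2 - k * a2" "x * y' + y * x' = k * a1 - h * b1" "y * y' = h * b0 - k * a0"
  unfolding x'_def y'_def f0_def f1_def f2_def h_def k_def by (simp_all add: algebra_simps power2_eq_square)

definition orbit2_s :: "(nat \<Rightarrow> 'a::field) \<Rightarrow> 'a" where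
  "orbit2_s d = (d 15 * FFd d (d 14) (d 16) 0 - d 13 * FFd d (d 14) (d 16) 1) * inverse (d 12)"

definition orbit2_t :: "(nat \<Rightarrow> 'a::field) \<Rightarrow> 'a" where
  "orbit2_t d = (d 15 * FFd d (d 14) (d 16) 1 - d 13 * FFd d (d 14) (d 16) 2) * inverse (d 12)"

text \<open>The constants of motion \<open>V(v 1)\<^sup>T A V(v 0) / r 0\<close> and \<open>V(v 1)\<^sup>T B V(v 0) / r 0\<close>.\<close>
definition invA :: "(nat \<Rightarrow> 'a::field) \<Rightarrow> 'a" where
  "invA d = (rowA d (d 14) (d 16) 0 * d 13 ^ 2 + rowA d (d 14) (d 16) 1 * (d 13 * d 15)
     + rowA d (d 14) (d 16) 2 * d 15 ^ 2) * inverse (d 12)"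

definition invB :: "(nat \<Rightarrow> 'a::field) \<Rightarrow> 'a" where
  "invB d = (rowB d (d 14) (d 16) 0 * d 13 ^ 2 + rowB d (d 14) (d 16) 1 * (d 13 * d 15)
     + rowB d (d 14) (d 16) 2 * d 15 ^ 2) * inverse (d 12)"

text \<open>Coefficients of the pencil member at \<open>v 2\<close> whose roots are
  \<open>v 1\<close> and \<open>v 3\<close>, with the common factor \<open>r 1\<close> already
  removed.\<close>

definition pencil_row :: "(nat \<Rightarrow> 'a::field) \<Rightarrow> nat \<Rightarrow> 'a" where
  "pencil_row d i = invA d * rowB d (orbit2_s d) (orbit2_t d) i - invB d * rowA d (orbit2_s d) (orbit2_t d) i"

lemma orbit2:
  "orbit_s d 2 = orbit2_s d" "orbit_t d 2 = orbit2_t d"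
  unfolding numeral_2_eq_2 orbit_steps orbit_initial orbit2_s_def orbit2_t_def
  by (simp_all add: divide_inverse numeral_2_eq_2)

lemma orbit3_eqs:
  "orbit_s d 3 = (d 16 * FFd d (orbit2_s d) (orbit2_t d) 0 - d 14 * FFd d (orbit2_s d) (orbit2_t d) 1) / orbit_r d 1"
  "orbit_t d 3 = (d 16 * FFd d (orbit2_s d) (orbit2_t d) 1 - d 14 * FFd d (orbit2_s d) (orbit2_t d) 2) / orbit_r d 1"
  using orbit_s_Suc_Suc[of d 1] orbit_t_Suc_Suc[of d 1] orbit2[of d] orbit_initial(4,5)[of d]
  by (simp_all add: numeral_3_eq_3 numeral_2_eq_2)

text \<open>Conservation of both constants from time 0 to time 1. The involution at
  \<open>v 1\<close> multiplies each form by \<open>Q(v 1) = r 0 * r 1\<close>, while the two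
  factors \<open>1 / r 0\<close> in \<open>v 2\<close> contribute \<open>r 0\<close> to the power
  -2.\<close>

lemma invA_step:
  assumes "d 12 \<noteq> 0"
  defines "s2 \<equiv> orbit2_s d" and "t2 \<equiv> orbit2_t d"
  shows "rowA d s2 t2 0 * d 14 ^ 2 + rowA d s2 t2 1 * (d 14 * d 16) + rowA d s2 t2 2 * d 16 ^ 2 = orbit_r d 1 * invA d"
    and "rowB d s2 t2 0 * d 14 ^ 2 + rowB d s2 t2 1 * (d 14 * d 16) + rowB d s2 t2 2 * d 16 ^ 2 = orbit_r d 1 * invB d"
proof -
  define i where "i = inverse (d 12)"
  define x y where "x = d 15 * FFd d (d 14) (d 16) 0 - d 13 * FFd d (d 14) (d 16) 1"
    and "y = d 15 * FFd d (d 14) (d 16) 1 - d 13 * FFd d (d 14) (d 16) 2"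
  have v2: "s2 = x * i" "t2 = y * i"
    by (simp_all add: s2_def t2_def orbit2_s_def orbit2_t_def x_def y_def i_def)
  have r1: "orbit_r d 1 = QQd d (d 14) (d 16) * i"
    using orbit_r_Suc[of d 0] by (simp add: orbit_initial i_def divide_inverse)
  \<comment> \<open>Symmetry of the matrix exchanges the roles of \<open>v 1\<close> and
    \<open>v 2\<close> in the biquadratic form.\<close>
  have "rowA d s2 t2 0 * d 14 ^ 2 + rowA d s2 t2 1 * (d 14 * d 16) + rowA d s2 t2 2 * d 16 ^ 2
      = rowA d (d 14) (d 16) 0 * s2 ^ 2 + rowA d (d 14) (d 16) 1 * (s2 * t2) + rowA d (d 14) (d 16) 2 * t2 ^ 2"
    unfolding row_simps by algebra
  also have "\<dots> = i ^ 2 * (rowA d (d 14) (d 16) 0 * x ^ 2 + rowA d (d 14) (d 16) 1 * (x * y) + rowA d (d 14) (d 16) 2 * y ^ 2)"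
    unfolding v2 by (simp add: algebra_simps power2_eq_square)
  also have "\<dots> = orbit_r d 1 * invA d"
    unfolding r1 x_def y_def FF_simps involution_form QQ_def invA_def i_def[symmetric]
    by (simp add: algebra_simps power2_eq_square)
  finally show "rowA d s2 t2 0 * d 14 ^ 2 + rowA d s2 t2 1 * (d 14 * d 16) + rowA d s2 t2 2 * d 16 ^ 2 = orbit_r d 1 * invA d" .
  have "rowB d s2 t2 0 * d 14 ^ 2 + rowB d s2 t2 1 * (d 14 * d 16) + rowB d s2 t2 2 * d 16 ^ 2
      = rowB d (d 14) (d 16) 0 * s2 ^ 2 + rowB d (d 14) (d 16) 1 * (s2 * t2) + rowB d (d 14) (d 16) 2 * t2 ^ 2"
    unfolding row_simps by algebra
  also have "\<dots> = i ^ 2 * (rowB d (d 14) (d 16) 0 * x ^ 2 + rowB d (d 14) (d 16) 1 * (x * y) + rowB d (d 14) (d 16) 2 * y ^ 2)"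
    unfolding v2 by (simp add: algebra_simps power2_eq_square)
  also have "\<dots> = orbit_r d 1 * invB d"
    unfolding r1 x_def y_def FF_simps involution_form QQ_def invB_def i_def[symmetric]
    by (simp add: algebra_simps power2_eq_square)
  finally show "rowB d s2 t2 0 * d 14 ^ 2 + rowB d s2 t2 1 * (d 14 * d 16) + rowB d s2 t2 2 * d 16 ^ 2 = orbit_r d 1 * invB d" .
qed

text \<open>By \<open>involution_products\<close> at \<open>v 2\<close>, the products of
  \<open>v 1\<close> with the numerators of \<open>v 3\<close> carry the factor \<open>r 1\<close>,
  because \<open>h\<close> and \<open>k\<close> do by \<open>invA_step\<close>; it cancels the
  denominator.\<close>

lemma orbit3_products:
  assumes "d 12 \<noteq> 0" "orbit_r d 1 \<noteq> 0"
  shows "d 14 * orbit_s d 3 = pencil_row d 2"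
    "d 14 * orbit_t d 3 + d 16 * orbit_s d 3 = - pencil_row d 1"
    "d 16 * orbit_t d 3 = pencil_row d 0"
proof -
  define x y where
    "x = d 16 * FFd d (orbit2_s d) (orbit2_t d) 0 - d 14 * FFd d (orbit2_s d) (orbit2_t d) 1" and
    "y = d 16 * FFd d (orbit2_s d) (orbit2_t d) 1 - d 14 * FFd d (orbit2_s d) (orbit2_t d) 2"
  note unfolds = x_def y_def FF_simps invA_step[where d = d, OF assms(1)] pencil_row_def
  have "d 14 * x = orbit_r d 1 * pencil_row d 2"
    unfolding unfolds involution_products(1) by (simp add: algebra_simps)
  moreover have "d 14 * y + d 16 * x = orbit_r d 1 * (- pencil_row d 1)"
    unfolding unfolds involution_products(2) by (simp add: algebra_simps)
  moreover have "d 16 * y = orbit_r d 1 * pencil_row d 0"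
    unfolding unfolds involution_products(3) by (simp add: algebra_simps)
  ultimately show "d 14 * orbit_s d 3 = pencil_row d 2"
    "d 14 * orbit_t d 3 + d 16 * orbit_s d 3 = - pencil_row d 1"
    "d 16 * orbit_t d 3 = pencil_row d 0"
    using assms(2) unfolding orbit3_eqs x_def[symmetric] y_def[symmetric]
    by (simp_all add: field_simps)
qed

text \<open>The involution at \<open>v 2\<close> squares to multiplication by
  \<open>Q(v 2) = r 1 * r 2\<close>. Applied to \<open>v 3\<close>, which is the image of
  \<open>v 1\<close> divided by \<open>r 1\<close>, it yields \<open>r 2 * v 1\<close>.\<close>

lemma orbit_r2_products:
  assumes "orbit_r d 1 \<noteq> 0"
  shows "orbit_r d 2 * d 14 = orbit_t d 3 * FFd d (orbit2_s d) (orbit2_t d) 0 - orbit_s d 3 * FFd d (orbit2_s d) (orbit2_t d) 1"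
    "orbit_r d 2 * d 16 = orbit_t d 3 * FFd d (orbit2_s d) (orbit2_t d) 1 - orbit_s d 3 * FFd d (orbit2_s d) (orbit2_t d) 2"
proof -
  have r2: "orbit_r d 2 = QQd d (orbit2_s d) (orbit2_t d) / orbit_r d 1"
    using orbit_r_Suc[of d 1] orbit2[of d] by (simp add: numeral_2_eq_2)
  show "orbit_r d 2 * d 14 = orbit_t d 3 * FFd d (orbit2_s d) (orbit2_t d) 0 - orbit_s d 3 * FFd d (orbit2_s d) (orbit2_t d) 1"
    "orbit_r d 2 * d 16 = orbit_t d 3 * FFd d (orbit2_s d) (orbit2_t d) 1 - orbit_s d 3 * FFd d (orbit2_s d) (orbit2_t d) 2"
    unfolding orbit3_eqs r2 QQ_def using assms
    by (simp_all add: divide_simps) (simp_all add: algebra_simps power2_eq_square)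
qed

section \<open>Laurent property of the iterates up to time 3\<close>

lemma localised_row:
  assumes "s \<in> laurent_ring" "t \<in> laurent_ring" "i \<in> {0, 1, 2}"
  shows "rowA Xf s t i \<in> laurent_ring" "rowB Xf s t i \<in> laurent_ring"
  using assms(3) by (auto simp: row_simps simp del: One_nat_def intro!: localised_intros assms(1,2))

lemma substitutes_row:
  assumes "substitutes d s s'" "substitutes d t t'" "i \<in> {0, 1, 2}"
  shows "substitutes d (rowA Xf s t i) (rowA d s' t' i)" "substitutes d (rowB Xf s t i) (rowB d s' t' i)"
  using assms(3) by (auto simp: row_simps simp del: One_nat_def intro!: substitutes_intros assms(1,2))

lemma localised_formulas:
  "orbit2_s Xf \<in> laurent_ring" "orbit2_t Xf \<in> laurent_ring"
  "i \<in> {0, 1, 2} \<Longrightarrow> pencil_row Xf i \<in> laurent_ring"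
proof -
  have v2: "orbit2_s Xf \<in> laurent_ring" "orbit2_t Xf \<in> laurent_ring"
    unfolding orbit2_s_def orbit2_t_def by (intro localised_intros localised_FF; simp)+
  then show "orbit2_s Xf \<in> laurent_ring" "orbit2_t Xf \<in> laurent_ring" .
  show "pencil_row Xf i \<in> laurent_ring" if "i \<in> {0, 1, 2}"
    unfolding pencil_row_def invA_def invB_def
    by (intro localised_intros localised_row v2 that; simp)
qed

lemma substitutes_formulas:
  "substitutes d (orbit2_s Xf) (orbit2_s d)" "substitutes d (orbit2_t Xf) (orbit2_t d)"
  "i \<in> {0, 1, 2} \<Longrightarrow> substitutes d (pencil_row Xf i) (pencil_row d i)"
proof -
  have v2: "substitutes d (orbit2_s Xf) (orbit2_s d)" "substitutes d (orbit2_t Xf) (orbit2_t d)"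
    unfolding orbit2_s_def orbit2_t_def by (intro substitutes_intros substitutes_FF; simp)+
  then show "substitutes d (orbit2_s Xf) (orbit2_s d)" "substitutes d (orbit2_t Xf) (orbit2_t d)" .
  show "substitutes d (pencil_row Xf i) (pencil_row d i)" if "i \<in> {0, 1, 2}"
    unfolding pencil_row_def invA_def invB_def
    by (intro substitutes_intros substitutes_row v2 that; simp)
qed

lemma substitutes_nonzero: "substitutes d x y \<Longrightarrow> y \<noteq> 0 \<Longrightarrow> d 12 \<noteq> 0 \<Longrightarrow> x \<noteq> 0"
  using substitutes_unique substitutes_zero by blast

text \<open>If two coprime elements both clear the denominator of \<open>z\<close>, there is none;
  \<open>z\<close> is an arbitrary element of the fraction field.\<close>

lemma coprime_in_quotient:
  assumes "coprime_in S p q" "q \<noteq> 0" "p * z \<in> localised S" "q * z \<in> localised S"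
  shows "z \<in> localised S"
proof -
  obtain w where "w \<in> localised S" "q * z = q * w"
    by (rule coprime_inD[OF assms(1,4,3)]) (simp add: algebra_simps)
  with assms(2) show ?thesis by simp
qed

lemma coprime_s1_t1: "coprime_in {..<17} (Xf 14) (Xf 16)"
  using coprime_in_linear[of "{..<17}" "Xf 14" 1 16 0]
  by (simp add: coprime_in_one localised_var localised_one localised_zero)

lemma laurent_3:
  assumes "orbit_r Xf 1 \<noteq> 0"
  shows "orbit_s Xf 3 \<in> laurent_ring" "orbit_t Xf 3 \<in> laurent_ring"
proof -
  note prods = orbit3_products[of Xf, OF Xf_nonzero assms]
  have mem: "Xf 14 * orbit_s Xf 3 \<in> laurent_ring" "Xf 16 * orbit_t Xf 3 \<in> laurent_ring"
    unfolding prods by (rule localised_formulas; simp)+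
  have mixed: "Xf 14 * orbit_t Xf 3 + Xf 16 * orbit_s Xf 3 \<in> laurent_ring"
    unfolding prods by (rule localised_uminus, rule localised_formulas) simp
  have X: "Xf 14 \<in> laurent_ring" "Xf 16 \<in> laurent_ring" by (auto intro: localised_var)
  \<comment> \<open>Eliminating \<open>t 3\<close> from the three products leaves
    \<open>t 1 ^ 2 * s 3\<close>, to be combined with \<open>s 1 * s 3\<close>. Eliminating
    \<open>s 3\<close> works symmetrically.\<close>
  have "Xf 16 * (Xf 14 * orbit_t Xf 3 + Xf 16 * orbit_s Xf 3) - Xf 14 * (Xf 16 * orbit_t Xf 3) \<in> laurent_ring"
    by (intro localised_diff localised_mult[OF X(2)] localised_mult[OF X(1)] mem mixed)
  then have s: "Xf 16 ^ 2 * orbit_s Xf 3 \<in> laurent_ring"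
    by (simp add: algebra_simps power2_eq_square)
  have "Xf 14 * (Xf 14 * orbit_t Xf 3 + Xf 16 * orbit_s Xf 3) - Xf 16 * (Xf 14 * orbit_s Xf 3) \<in> laurent_ring"
    by (intro localised_diff localised_mult[OF X(2)] localised_mult[OF X(1)] mem mixed)
  then have t: "Xf 14 ^ 2 * orbit_t Xf 3 \<in> laurent_ring"
    by (simp add: algebra_simps power2_eq_square)
  show "orbit_s Xf 3 \<in> laurent_ring"
    using coprime_in_power_right[OF coprime_s1_t1 X(2)] by (rule coprime_in_quotient) (use mem s in simp_all)
  show "orbit_t Xf 3 \<in> laurent_ring"
    using coprime_in_power_right[OF coprime_in_sym[OF coprime_s1_t1] X(1)]
    by (rule coprime_in_quotient) (use mem t in simp_all)
qed

lemma orbit_r1: "orbit_r Xf 1 = QQd Xf (Xf 14) (Xf 16) * inverse (Xf 12)"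
  using orbit_r_Suc[of Xf 0] by (simp add: orbit_initial divide_inverse)

lemma laurent_0: "laurent_at 0"
  unfolding laurent_at_def orbit_initial by (auto intro: localised_var)

lemma laurent_1: "laurent_at 1"
proof -
  have "orbit_r Xf 1 \<in> laurent_ring"
    unfolding orbit_r1 by (intro localised_intros localised_QQ) auto
  then show ?thesis
    unfolding laurent_at_def One_nat_def orbit_initial by (auto intro: localised_var)
qed

lemma orbit_r1_nonzero: "orbit_r Xf 1 \<noteq> 0"
  using laurent_0 laurent_1 by (intro orbit_r_nonzero) (metis One_nat_def le_Suc_eq le_zero_eq)

text \<open>With \<open>v 3\<close> already Laurent, so are \<open>r 2 * s 1\<close> and
  \<open>r 2 * t 1\<close>, and \<open>s 1\<close>, \<open>t 1\<close> are coprime.\<close>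

lemma laurent_2: "laurent_at 2"
proof -
  have F: "FFd Xf (orbit2_s Xf) (orbit2_t Xf) i \<in> laurent_ring" for i
    by (intro localised_FF localised_formulas)
  have "Xf 14 * orbit_r Xf 2 \<in> laurent_ring" "Xf 16 * orbit_r Xf 2 \<in> laurent_ring"
    unfolding mult.commute[of _ "orbit_r Xf 2"] orbit_r2_products[OF orbit_r1_nonzero]
    by (intro localised_diff localised_mult laurent_3 orbit_r1_nonzero F)+
  then have "orbit_r Xf 2 \<in> laurent_ring"
    by (rule coprime_in_quotient[OF coprime_s1_t1 Xf_nonzero])
  then show ?thesis
    unfolding laurent_at_def orbit2 by (simp add: localised_formulas)
qed

subsection \<open>Coprimality of r 2 and Q(v 1)\<close>

text \<open>The squares of these two elements are the leading coefficients of \<open>Q(v 1)\<close>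
  in \<open>a 0 0\<close> and \<open>a 2 2\<close>. Each pair of factors is treated by
  \<open>coprime_in_linear\<close>, using an entry of \<open>B\<close> whose coefficient is a power
  of \<open>s 1\<close> or \<open>t 1\<close>.\<close>

lemma coprime_leading_coeffs:
  defines "b0 \<equiv> rowB Xf (Xf 14) (Xf 16) 0" and "b2 \<equiv> rowB Xf (Xf 14) (Xf 16) 2"
  shows "coprime_in {..<17} (b2 * Xf 14 ^ 2) (b0 * Xf 16 ^ 2)" "b0 \<noteq> 0" "b2 \<noteq> 0"
    "b0 \<in> laurent_ring" "b2 \<in> laurent_ring"
proof -
  have st: "Xf 14 \<in> laurent_ring" "Xf 16 \<in> laurent_ring" by (auto intro: localised_var)
  show b: "b0 \<in> laurent_ring" "b2 \<in> laurent_ring"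
    unfolding b0_def b2_def by (intro localised_row st; simp)+
  have "substitutes (\<lambda>_. 1 :: rat) b0 (rowB (\<lambda>_. 1) 1 1 0)" "substitutes (\<lambda>_. 1 :: rat) b2 (rowB (\<lambda>_. 1) 1 1 2)"
    unfolding b0_def b2_def using substitutes_var[of _ "\<lambda>_. 1 :: rat"] by (intro substitutes_row; simp)+
  then show nz: "b0 \<noteq> 0" "b2 \<noteq> 0"
    by (simp_all add: row_simps substitutes_nonzero)
  have s_t2: "coprime_in {..<17} (Xf 14) (Xf 16 ^ 2)"
    by (rule coprime_in_power_right[OF coprime_s1_t1 st(2)]) simp
  have t_s2: "coprime_in {..<17} (Xf 16) (Xf 14 ^ 2)"
    by (rule coprime_in_power_right[OF coprime_in_sym[OF coprime_s1_t1] st(1)]) simp_all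
  have "coprime_in {..<17} (Xf 14) (Xf 16 ^ 2 * Xf 8 + (Xf 6 * Xf 14 ^ 2 + Xf 7 * (Xf 14 * Xf 16)))"
    by (rule coprime_in_linear[OF s_t2]) (auto intro!: localised_intros)
  then have s_b0: "coprime_in {..<17} (Xf 14) b0"
    by (simp add: b0_def row_simps algebra_simps)
  have "coprime_in {..<17} (Xf 16) (Xf 14 ^ 2 * Xf 8 + (Xf 10 * (Xf 14 * Xf 16) + Xf 11 * Xf 16 ^ 2))"
    by (rule coprime_in_linear[OF t_s2]) (auto intro!: localised_intros)
  then have t_b2: "coprime_in {..<17} (Xf 16) b2"
    by (simp add: b2_def row_simps algebra_simps)
  have "coprime_in {..<17} (Xf 14) (Xf 16 ^ 2 * Xf 11 + (Xf 8 * Xf 14 ^ 2 + Xf 10 * (Xf 14 * Xf 16)))"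
    by (rule coprime_in_linear[OF s_t2]) (auto intro!: localised_intros)
  then have s_b2: "coprime_in {..<17} (Xf 14) b2"
    by (simp add: b2_def row_simps algebra_simps)
  have b2_s2: "coprime_in {..<17} b2 (Xf 14 ^ 2)"
    by (rule coprime_in_power_right[OF coprime_in_sym[OF s_b2 nz(2)] st(1) Xf_nonzero])
  \<comment> \<open>The indeterminate \<open>b 0 0\<close>, numbered 6, is absent from
    \<open>b2\<close> and occurs in \<open>b0\<close> with coefficient
    \<open>s 1 ^ 2\<close>.\<close>
  have b2_free: "b2 \<in> localised ({..<17} - {6})"
    unfolding b2_def row_simps by (intro localised_intros; simp)
  have "coprime_in {..<17} b2 (Xf 14 ^ 2 * Xf 6 + (Xf 7 * (Xf 14 * Xf 16) + Xf 8 * Xf 16 ^ 2))"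
    by (rule coprime_in_linear[OF b2_s2 b2_free _ _ _ _ _ nz(2)]) (auto intro!: localised_intros)
  then have b2_b0: "coprime_in {..<17} b2 b0"
    by (simp add: b0_def row_simps algebra_simps)
  have s2: "Xf 14 ^ 2 \<in> laurent_ring" and t2: "Xf 16 ^ 2 \<in> laurent_ring"
    by (intro localised_power st)+
  have p_nz: "b2 * Xf 14 ^ 2 \<noteq> 0" using nz by simp
  have "coprime_in {..<17} b0 (b2 * Xf 14 ^ 2)"
    by (rule coprime_in_mult_right[OF coprime_in_sym[OF b2_b0 nz(1)]
          coprime_in_power_right[OF coprime_in_sym[OF s_b0 nz(1)] st(1) Xf_nonzero] b(2) s2 nz(2)])
  note p_b0 = coprime_in_sym[OF this p_nz]
  have "coprime_in {..<17} (Xf 16) (b2 * Xf 14 ^ 2)"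
    by (rule coprime_in_mult_right[OF t_b2 t_s2 b(2) s2 nz(2)])
  note p_t2 = coprime_in_power_right[OF coprime_in_sym[OF this p_nz] st(2) Xf_nonzero]
  show "coprime_in {..<17} (b2 * Xf 14 ^ 2) (b0 * Xf 16 ^ 2)"
    by (rule coprime_in_mult_right[OF p_b0 p_t2 b(1) t2 nz(1)])
qed

text \<open>At the specialisations used below \<open>Q(v 1)\<close> and hence \<open>r 1\<close>
  vanish, so the specialised recursion would divide by zero. The value \<open>e\<close> of
  \<open>r 2\<close> is instead pinned down by specialising identities free of
  \<open>r 1\<close>.\<close>

lemma substitutes_r2:
  assumes d: "d 12 \<noteq> 0"
  obtains e s3 t3 where "substitutes d (orbit_r Xf 2) e"
    "d 14 * s3 = pencil_row d 2" "d 14 * t3 + d 16 * s3 = - pencil_row d 1" "d 16 * t3 = pencil_row d 0"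
    "e * d 14 = t3 * FFd d (orbit2_s d) (orbit2_t d) 0 - s3 * FFd d (orbit2_s d) (orbit2_t d) 1"
    "e * d 16 = t3 * FFd d (orbit2_s d) (orbit2_t d) 1 - s3 * FFd d (orbit2_s d) (orbit2_t d) 2"
proof -
  obtain e where e: "substitutes d (orbit_r Xf 2) e"
    using laurent_2 substitutes_exists unfolding laurent_at_def by blast
  obtain s3 where s3: "substitutes d (orbit_s Xf 3) s3"
    using substitutes_exists laurent_3[OF orbit_r1_nonzero] by blast
  obtain t3 where t3: "substitutes d (orbit_t Xf 3) t3"
    using substitutes_exists laurent_3[OF orbit_r1_nonzero] by blast
  have var: "substitutes d (Xf 14) (d 14)" "substitutes d (Xf 16) (d 16)"
    by (rule substitutes_var; simp)+
  note subst = substitutes_diff substitutes_add substitutes_mult substitutes_uminus var s3 t3 e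
    substitutes_FF substitutes_formulas
  note prods = orbit3_products[of Xf, OF Xf_nonzero orbit_r1_nonzero]
  have "substitutes d (Xf 14 * orbit_s Xf 3) (d 14 * s3)"
    "substitutes d (Xf 14 * orbit_t Xf 3 + Xf 16 * orbit_s Xf 3) (d 14 * t3 + d 16 * s3)"
    "substitutes d (Xf 16 * orbit_t Xf 3) (d 16 * t3)"
    "substitutes d (orbit_r Xf 2 * Xf 14) (e * d 14)" "substitutes d (orbit_r Xf 2 * Xf 16) (e * d 16)"
    by (intro subst)+
  moreover have "substitutes d (Xf 14 * orbit_s Xf 3) (pencil_row d 2)"
    "substitutes d (Xf 14 * orbit_t Xf 3 + Xf 16 * orbit_s Xf 3) (- pencil_row d 1)"
    "substitutes d (Xf 16 * orbit_t Xf 3) (pencil_row d 0)"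
    "substitutes d (orbit_r Xf 2 * Xf 14)
      (t3 * FFd d (orbit2_s d) (orbit2_t d) 0 - s3 * FFd d (orbit2_s d) (orbit2_t d) 1)"
    "substitutes d (orbit_r Xf 2 * Xf 16)
      (t3 * FFd d (orbit2_s d) (orbit2_t d) 1 - s3 * FFd d (orbit2_s d) (orbit2_t d) 2)"
    unfolding prods orbit_r2_products[OF orbit_r1_nonzero] by (intro subst; simp)+
  ultimately show ?thesis
    using that[OF e] substitutes_unique[where d = d, OF _ _ d] by blast
qed

text \<open>The specialisation \<open>d\<close> below is chosen so that \<open>Q(v 1)\<close> becomes the square of the entry
  \<open>a 0 0\<close> while \<open>r 2\<close> takes the value 1 at \<open>a 0 0 = 0\<close>. Reversing the indices 0, 1, 2 and
  swapping \<open>s\<close> and \<open>t\<close> gives the one for \<open>a 2 2\<close>.\<close>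
lemma r2_cancel_a00:
  assumes xy: "x \<in> laurent_ring" "y \<in> laurent_ring" "orbit_r Xf 2 * x = QQd Xf (Xf 14) (Xf 16) * y"
  obtains k g where "g \<in> laurent_ring"
    "((rowB Xf (Xf 14) (Xf 16) 2 * Xf 14 ^ 2) ^ 2) ^ k * x = QQd Xf (Xf 14) (Xf 16) * g"
proof -
  \<comment> \<open>Up to symmetry only \<open>a 0 1 = 1\<close> and \<open>b 0 2 = 1\<close> are
    nonzero; moreover \<open>r 0 = 1\<close>, \<open>v 0 = (0, 1)\<close> and
    \<open>v 1 = (1, 0)\<close>.\<close>
  define d :: "nat \<Rightarrow> rat" where "d i = (if i \<in> {1, 8, 12, 14, 15} then 1 else 0)" for i
  have d_vals: "d 0 = 0" "d (Suc 0) = 1" "d 2 = 0" "d 3 = 0" "d 4 = 0" "d 5 = 0" "d 6 = 0" "d 7 = 0"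
    "d 8 = 1" "d 9 = 0" "d 10 = 0" "d 11 = 0" "d 12 = 1" "d 13 = 0" "d 14 = 1" "d 15 = 1" "d 16 = 0"
    by (simp_all add: d_def)
  have v2: "orbit2_s d = 1" "orbit2_t d = 0"
    unfolding orbit2_s_def orbit2_t_def FF_simps row_simps by (simp_all add: d_vals)
  have pencil: "pencil_row d 2 = 0" "pencil_row d 1 = -1"
    unfolding pencil_row_def invA_def invB_def v2 row_simps by (simp_all add: d_vals)
  have F: "FFd d 1 0 0 = 1"
    unfolding FF_simps row_simps by (simp_all add: d_vals)
  obtain e s3 t3 where e: "substitutes d (orbit_r Xf 2) e"
    "d 14 * s3 = pencil_row d 2" "d 14 * t3 + d 16 * s3 = - pencil_row d 1"
    "e * d 14 = t3 * FFd d (orbit2_s d) (orbit2_t d) 0 - s3 * FFd d (orbit2_s d) (orbit2_t d) 1"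
    using substitutes_r2[of d] d_vals(13) by (metis zero_neq_one)
  have "s3 = 0" "t3 = 1" using e(2,3) unfolding pencil by (simp_all add: d_vals)
  with e(4) have e_val: "e = 1" by (simp add: d_vals v2 F)
  define s t where "s = Xf 14" and "t = Xf 16"
  \<comment> \<open>\<open>a\<close> is the part of the first row value free of
    \<open>a 0 0\<close>; \<open>q0\<close>, \<open>q1\<close>, \<open>q2\<close> then come from
    expanding \<open>Q(v 1)\<close> in \<open>a 0 0\<close>.\<close>
  define a where "a = Xf 1 * (s * t) + Xf 2 * t ^ 2"
  define a1 a2 b0 b1 b2 where rows: "a1 = rowA Xf s t 1" "a2 = rowA Xf s t 2" "b0 = rowB Xf s t 0"
    "b1 = rowB Xf s t 1" "b2 = rowB Xf s t 2"
  define q0 where "q0 = (a2 * b0 - a * b2) ^ 2 - (a1 * b2 - a2 * b1) * (a * b1 - a1 * b0)"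
  define q1 where "q1 = - (2 * (b2 * s ^ 2) * (a2 * b0 - a * b2) + (a1 * b2 - a2 * b1) * (b1 * s ^ 2))"
  define q2 where "q2 = (b2 * s ^ 2) ^ 2"
  have a0: "rowA Xf s t 0 = s ^ 2 * Xf 0 + a" by (simp add: row_simps a_def algebra_simps)
  have Q: "QQd Xf s t = q2 * Xf 0 ^ 2 + q1 * Xf 0 + q0"
    unfolding QQ_def FF_simps a0 rows[symmetric] q0_def q1_def q2_def
    by (simp add: algebra_simps power2_eq_square)
  have free: "a \<in> localised ({..<17} - {0})" "s \<in> localised ({..<17} - {0})" "a1 \<in> localised ({..<17} - {0})"
    "a2 \<in> localised ({..<17} - {0})" "b0 \<in> localised ({..<17} - {0})" "b1 \<in> localised ({..<17} - {0})"
    "b2 \<in> localised ({..<17} - {0})"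
    unfolding a_def rows row_simps s_def t_def by (intro localised_intros; simp)+
  have q_mem: "q0 \<in> localised ({..<17} - {0})" "q1 \<in> localised ({..<17} - {0})" "q2 \<in> localised ({..<17} - {0})"
    unfolding q0_def q1_def q2_def by (intro localised_intros free)+
  have st_sub: "substitutes d s 1" "substitutes d t 0"
    using substitutes_var[of 14 d] substitutes_var[of 16 d] by (simp_all add: d_vals s_def t_def)
  have a_sub: "substitutes d a (d 1 * (1 * 0) + d 2 * 0 ^ 2)"
    unfolding a_def by (intro substitutes_intros st_sub; simp)
  have row_sub: "substitutes d a1 (rowA d 1 0 1)" "substitutes d a2 (rowA d 1 0 2)" "substitutes d b0 (rowB d 1 0 0)"
    "substitutes d b1 (rowB d 1 0 1)" "substitutes d b2 (rowB d 1 0 2)"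
    unfolding rows by (intro substitutes_row st_sub; simp)+
  have sub: "substitutes d a 0" "substitutes d a1 1" "substitutes d a2 0" "substitutes d b0 0"
    "substitutes d b1 0" "substitutes d b2 1"
    using a_sub row_sub unfolding row_simps by (simp_all add: d_vals)
  have "substitutes d q2 ((1 * 1 ^ 2) ^ 2)" unfolding q2_def by (intro substitutes_intros sub st_sub)
  then have q2_sub: "substitutes d q2 1" by simp
  \<comment> \<open>The numeral 2 is split because the substitution rules provide only the constants
    0 and 1.\<close>
  have "substitutes d q1 (- ((1 + 1) * (1 * 1 ^ 2) * (0 * 0 - 0 * 1) + (1 * 1 - 0 * 0) * (0 * 1 ^ 2)))"
    unfolding q1_def one_add_one[symmetric] by (intro substitutes_intros sub st_sub)
  then have q1_sub: "substitutes d q1 0" by simp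
  have "substitutes d q0 ((0 * 0 - 0 * 1) ^ 2 - (1 * 1 - 0 * 0) * (0 * 0 - 1 * 0))"
    unfolding q0_def by (intro substitutes_intros sub st_sub)
  then have q0_sub: "substitutes d q0 0" by simp
  have r2_mem: "orbit_r Xf 2 \<in> laurent_ring" using laurent_2 by (simp add: laurent_at_def)
  have eq: "orbit_r Xf 2 * x = (q2 * Xf 0 ^ 2 + q1 * Xf 0 + q0) * y"
    using xy(3) unfolding Q[symmetric] s_def t_def .
  obtain k g where "g \<in> laurent_ring" "q2 ^ k * x = (q2 * Xf 0 ^ 2 + q1 * Xf 0 + q0) * g"
    by (rule quadratic_cancel[OF _ _ _ q_mem r2_mem xy(1,2) eq _ _ q2_sub q1_sub q0_sub e(1)])
      (simp_all add: d_vals e_val)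
  then show ?thesis using that unfolding Q[symmetric] by (simp add: q2_def rows s_def t_def)
qed

lemma r2_cancel_a22:
  assumes xy: "x \<in> laurent_ring" "y \<in> laurent_ring" "orbit_r Xf 2 * x = QQd Xf (Xf 14) (Xf 16) * y"
  obtains k g where "g \<in> laurent_ring"
    "((rowB Xf (Xf 14) (Xf 16) 0 * Xf 16 ^ 2) ^ 2) ^ k * x = QQd Xf (Xf 14) (Xf 16) * g"
proof -
  \<comment> \<open>The mirrored choice: \<open>a 1 2 = b 0 2 = 1\<close>,
    \<open>v 0 = (1, 0)\<close> and \<open>v 1 = (0, 1)\<close>.\<close>
  define d :: "nat \<Rightarrow> rat" where "d i = (if i \<in> {4, 8, 12, 13, 16} then 1 else 0)" for i
  have d_vals: "d 0 = 0" "d (Suc 0) = 0" "d 2 = 0" "d 3 = 0" "d 4 = 1" "d 5 = 0" "d 6 = 0" "d 7 = 0"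
    "d 8 = 1" "d 9 = 0" "d 10 = 0" "d 11 = 0" "d 12 = 1" "d 13 = 1" "d 14 = 0" "d 15 = 0" "d 16 = 1"
    by (simp_all add: d_def)
  have v2: "orbit2_s d = 0" "orbit2_t d = 1"
    unfolding orbit2_s_def orbit2_t_def FF_simps row_simps by (simp_all add: d_vals)
  have pencil: "pencil_row d 0 = 0" "pencil_row d 1 = -1"
    unfolding pencil_row_def invA_def invB_def v2 row_simps by (simp_all add: d_vals)
  have F: "FFd d 0 1 2 = -1"
    unfolding FF_simps row_simps by (simp_all add: d_vals)
  obtain e s3 t3 where e: "substitutes d (orbit_r Xf 2) e"
    "d 14 * t3 + d 16 * s3 = - pencil_row d 1" "d 16 * t3 = pencil_row d 0"
    "e * d 16 = t3 * FFd d (orbit2_s d) (orbit2_t d) 1 - s3 * FFd d (orbit2_s d) (orbit2_t d) 2"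
    using substitutes_r2[of d] d_vals(13) by (metis zero_neq_one)
  have "s3 = 1" "t3 = 0" using e(2,3) unfolding pencil by (simp_all add: d_vals)
  with e(4) have e_val: "e = 1" by (simp add: d_vals v2 F)
  define s t where "s = Xf 14" and "t = Xf 16"
  define a where "a = Xf 2 * s ^ 2 + Xf 4 * (s * t)"
  define a0 a1 b0 b1 b2 where rows: "a0 = rowA Xf s t 0" "a1 = rowA Xf s t 1" "b0 = rowB Xf s t 0"
    "b1 = rowB Xf s t 1" "b2 = rowB Xf s t 2"
  define q0 where "q0 = (a * b0 - a0 * b2) ^ 2 - (a1 * b2 - a * b1) * (a0 * b1 - a1 * b0)"
  define q1 where "q1 = 2 * (b0 * t ^ 2) * (a * b0 - a0 * b2) + (b1 * t ^ 2) * (a0 * b1 - a1 * b0)"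
  define q2 where "q2 = (b0 * t ^ 2) ^ 2"
  have a2: "rowA Xf s t 2 = t ^ 2 * Xf 5 + a" by (simp add: row_simps a_def algebra_simps)
  have Q: "QQd Xf s t = q2 * Xf 5 ^ 2 + q1 * Xf 5 + q0"
    unfolding QQ_def FF_simps a2 rows[symmetric] q0_def q1_def q2_def
    by (simp add: algebra_simps power2_eq_square)
  have free: "a \<in> localised ({..<17} - {5})" "t \<in> localised ({..<17} - {5})" "a0 \<in> localised ({..<17} - {5})"
    "a1 \<in> localised ({..<17} - {5})" "b0 \<in> localised ({..<17} - {5})" "b1 \<in> localised ({..<17} - {5})"
    "b2 \<in> localised ({..<17} - {5})"
    unfolding a_def rows row_simps s_def t_def by (intro localised_intros; simp)+
  have q_mem: "q0 \<in> localised ({..<17} - {5})" "q1 \<in> localised ({..<17} - {5})" "q2 \<in> localised ({..<17} - {5})"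
    unfolding q0_def q1_def q2_def by (intro localised_intros free)+
  have st_sub: "substitutes d s 0" "substitutes d t 1"
    using substitutes_var[of 14 d] substitutes_var[of 16 d] by (simp_all add: d_vals s_def t_def)
  have a_sub: "substitutes d a (d 2 * 0 ^ 2 + d 4 * (0 * 1))"
    unfolding a_def by (intro substitutes_intros st_sub; simp)
  have row_sub: "substitutes d a0 (rowA d 0 1 0)" "substitutes d a1 (rowA d 0 1 1)" "substitutes d b0 (rowB d 0 1 0)"
    "substitutes d b1 (rowB d 0 1 1)" "substitutes d b2 (rowB d 0 1 2)"
    unfolding rows by (intro substitutes_row st_sub; simp)+
  have sub: "substitutes d a 0" "substitutes d a0 0" "substitutes d a1 1" "substitutes d b0 1"
    "substitutes d b1 0" "substitutes d b2 0"
    using a_sub row_sub unfolding row_simps by (simp_all add: d_vals)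
  have "substitutes d q2 ((1 * 1 ^ 2) ^ 2)" unfolding q2_def by (intro substitutes_intros sub st_sub)
  then have q2_sub: "substitutes d q2 1" by simp
  have "substitutes d q1 ((1 + 1) * (1 * 1 ^ 2) * (0 * 1 - 0 * 0) + (0 * 1 ^ 2) * (0 * 0 - 1 * 1))"
    unfolding q1_def one_add_one[symmetric] by (intro substitutes_intros sub st_sub)
  then have q1_sub: "substitutes d q1 0" by simp
  have "substitutes d q0 ((0 * 1 - 0 * 0) ^ 2 - (1 * 0 - 0 * 0) * (0 * 0 - 1 * 1))"
    unfolding q0_def by (intro substitutes_intros sub st_sub)
  then have q0_sub: "substitutes d q0 0" by simp
  have r2_mem: "orbit_r Xf 2 \<in> laurent_ring" using laurent_2 by (simp add: laurent_at_def)
  have eq: "orbit_r Xf 2 * x = (q2 * Xf 5 ^ 2 + q1 * Xf 5 + q0) * y"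
    using xy(3) unfolding Q[symmetric] s_def t_def .
  obtain k g where "g \<in> laurent_ring" "q2 ^ k * x = (q2 * Xf 5 ^ 2 + q1 * Xf 5 + q0) * g"
    by (rule quadratic_cancel[OF _ _ _ q_mem r2_mem xy(1,2) eq _ _ q2_sub q1_sub q0_sub e(1)])
      (simp_all add: d_vals e_val)
  then show ?thesis using that unfolding Q[symmetric] by (simp add: q2_def rows s_def t_def)
qed

lemma QQ_initial_nonzero: "QQd Xf (Xf 14) (Xf 16) \<noteq> 0"
  using orbit_r1_nonzero orbit_r1 by auto

lemma coprime_r2_QQ: "coprime_in {..<17} (orbit_r Xf 2) (QQd Xf (Xf 14) (Xf 16))"
  unfolding coprime_in_def
proof (intro ballI impI)
  define Q where "Q = QQd Xf (Xf 14) (Xf 16)"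
  define \<kappa> where "\<kappa> = rowB Xf (Xf 14) (Xf 16) 2 * Xf 14 ^ 2"
  define \<mu> where "\<mu> = rowB Xf (Xf 14) (Xf 16) 0 * Xf 16 ^ 2"
  have Q: "Q \<noteq> 0" unfolding Q_def by (rule QQ_initial_nonzero)
  have nz: "\<kappa> \<noteq> 0" "\<mu> \<noteq> 0"
    using coprime_leading_coeffs(2,3) by (simp_all add: \<kappa>_def \<mu>_def)
  have mem: "\<kappa> \<in> laurent_ring" "\<mu> \<in> laurent_ring"
    unfolding \<kappa>_def \<mu>_def by (intro localised_intros coprime_leading_coeffs(4,5); simp)+
  fix x y assume "x \<in> laurent_ring" "y \<in> laurent_ring"
    "orbit_r Xf 2 * x = QQd Xf (Xf 14) (Xf 16) * y"
  note xy = this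
  obtain k g where g: "g \<in> laurent_ring" "(\<kappa> ^ 2) ^ k * x = Q * g"
    using r2_cancel_a00[OF xy] unfolding Q_def \<kappa>_def by blast
  obtain l h where h: "h \<in> laurent_ring" "(\<mu> ^ 2) ^ l * x = Q * h"
    using r2_cancel_a22[OF xy] unfolding Q_def \<mu>_def by blast
  \<comment> \<open>Cross-multiplying the two partial divisibilities and cancelling \<open>Q\<close>
    relates \<open>g\<close> and \<open>h\<close>; coprimality then makes \<open>g\<close> a
    multiple of the power of \<open>\<kappa>\<close>, which cancels from \<open>x\<close>.\<close>
  have "Q * ((\<mu> ^ 2) ^ l * g) = (\<mu> ^ 2) ^ l * ((\<kappa> ^ 2) ^ k * x)" unfolding g(2) by simp
  also have "\<dots> = (\<kappa> ^ 2) ^ k * ((\<mu> ^ 2) ^ l * x)" by (simp add: mult.left_commute)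
  also have "\<dots> = Q * ((\<kappa> ^ 2) ^ k * h)" unfolding h(2) by (simp add: mult.left_commute)
  finally have "(\<mu> ^ 2) ^ l * g = (\<kappa> ^ 2) ^ k * h" using Q by simp
  moreover have "coprime_in {..<17} \<mu> \<kappa>"
    using coprime_leading_coeffs(1) nz(2) unfolding \<kappa>_def \<mu>_def by (rule coprime_in_sym)
  then have "coprime_in {..<17} ((\<mu> ^ 2) ^ l) ((\<kappa> ^ 2) ^ k)"
    unfolding power_mult[symmetric] by (intro coprime_in_powers mem nz)
  ultimately obtain w where w: "w \<in> laurent_ring" "g = (\<kappa> ^ 2) ^ k * w"
    using coprime_inD g(1) h(1) by metis
  have "(\<kappa> ^ 2) ^ k * x = (\<kappa> ^ 2) ^ k * (Q * w)"
    unfolding g(2) w(2) by (simp add: mult.left_commute)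
  then have "x = Q * w" using nz(1) by simp
  with w(1) show "\<exists>w\<in>laurent_ring. x = QQd Xf (Xf 14) (Xf 16) * w"
    unfolding Q_def by blast
qed

subsection \<open>The Laurent property\<close>

text \<open>Substituting ring elements into a Laurent polynomial creates no denominators other than
  powers of the value given to \<open>r 0\<close>.\<close>

lemma substitutes_denominator:
  assumes "substitutes d x y" "d 12 \<noteq> 0" "\<And>i. i < 17 \<Longrightarrow> d i \<in> localised S"
  shows "\<exists>k. d 12 ^ k * y \<in> localised S"
  using assms(1)
proof induction
  case substitutes_one
  show ?case by (intro exI[of _ 0]) (simp add: localised_one)
next
  case (substitutes_var i)
  then show ?case by (intro exI[of _ 0]) (simp add: assms(3))
next
  case substitutes_inverse
  show ?case using assms(2) by (intro exI[of _ 1]) (simp add: localised_one)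
next
  case (substitutes_diff x y x' y')
  then obtain k l where kl: "d 12 ^ k * y \<in> localised S" "d 12 ^ l * y' \<in> localised S" by blast
  have "d 12 ^ l * (d 12 ^ k * y) - d 12 ^ k * (d 12 ^ l * y') \<in> localised S"
    by (intro localised_diff localised_mult[OF localised_power] kl assms(3)) simp_all
  then show ?case
    by (intro exI[of _ "k + l"]) (simp add: power_add algebra_simps)
next
  case (substitutes_mult x y x' y')
  then obtain k l where kl: "d 12 ^ k * y \<in> localised S" "d 12 ^ l * y' \<in> localised S" by blast
  have "(d 12 ^ k * y) * (d 12 ^ l * y') \<in> localised S"
    by (intro localised_mult kl)
  then show ?case
    by (intro exI[of _ "k + l"]) (simp add: power_add algebra_simps)
qed

text \<open>The iterate at time \<open>m + n\<close> is the generic iterate at time \<open>n\<close>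
  with the data of times \<open>m\<close> and \<open>m + 1\<close> substituted, so a power of
  \<open>r m\<close> clears its denominator.\<close>

lemma orbit_denominator:
  assumes laurent: "\<And>i. i \<le> n \<Longrightarrow> laurent_at i" and laurent_m: "laurent_at m"
    and sm: "orbit_s Xf (Suc m) \<in> laurent_ring" "orbit_t Xf (Suc m) \<in> laurent_ring"
    and nz: "orbit_r Xf m \<noteq> 0" "\<And>i. i < n \<Longrightarrow> orbit_r Xf (m + i) \<noteq> 0"
    and z: "z = orbit_r Xf (m + n) \<or> z = orbit_s Xf (m + n) \<or> z = orbit_t Xf (m + n)"
  shows "\<exists>k. orbit_r Xf m ^ k * z \<in> laurent_ring"
proof -
  define d :: "nat \<Rightarrow> mpoly fract" where "d = shift_data m Xf"
  have d12: "d 12 = orbit_r Xf m" by (simp add: d_def shift_data_def)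
  have mem: "d i \<in> laurent_ring" if "i < 17" for i
    using that laurent_m sm
    by (auto simp: d_def shift_data_def laurent_at_def intro: localised_var)
  have orbit_d: "orbit_r d i = orbit_r Xf (m + i)" "orbit_s d i = orbit_s Xf (m + i)"
    "orbit_t d i = orbit_t Xf (m + i)" for i
    using orbit_shift[of m Xf i] by (simp_all add: d_def)
  have "substitutes d (orbit_r Xf n) (orbit_r d n) \<and> substitutes d (orbit_s Xf n) (orbit_s d n) \<and>
    substitutes d (orbit_t Xf n) (orbit_t d n)"
  proof (rule substitutes_orbit)
    show "orbit_r Xf i \<noteq> 0" if "i < n" for i
      using that laurent by (intro orbit_r_nonzero) simp
  qed (use laurent nz d12 in \<open>simp_all add: orbit_d\<close>)
  with z obtain x where "substitutes d x z" unfolding orbit_d by blast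
  from substitutes_denominator[OF this] show ?thesis
    using nz(1) mem by (simp add: d12)
qed

lemma laurent_at_all: "laurent_at n"
proof (induction n rule: less_induct)
  case (less n)
  show ?case
  proof (cases "n < 3")
    case True
    then have "n = 0 \<or> n = 1 \<or> n = 2" by auto
    then show ?thesis using laurent_0 laurent_1 laurent_2 by blast
  next
    case False
    have nz: "orbit_r Xf i \<noteq> 0" if "i < n" for i
      using less that by (intro orbit_r_nonzero) simp
    have r2_mem: "orbit_r Xf 2 \<in> laurent_ring"
      using laurent_2 by (simp add: laurent_at_def)
    have "z \<in> laurent_ring"
      if z: "z = orbit_r Xf n \<or> z = orbit_s Xf n \<or> z = orbit_t Xf n" for z
    proof -
      define Q where "Q = QQd Xf (Xf 14) (Xf 16)"
      have "\<exists>k. orbit_r Xf 1 ^ k * z \<in> laurent_ring"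
      proof (rule orbit_denominator[of "n - 1"])
        show "orbit_s Xf (Suc 1) \<in> laurent_ring" "orbit_t Xf (Suc 1) \<in> laurent_ring"
          using laurent_2 by (simp_all add: laurent_at_def numeral_2_eq_2)
      qed (use less False nz laurent_1 z in auto)
      then obtain k where k: "orbit_r Xf 1 ^ k * z \<in> laurent_ring" ..
      have "\<exists>k. orbit_r Xf 2 ^ k * z \<in> laurent_ring"
      proof (rule orbit_denominator[of "n - 2"])
        \<comment> \<open>Restarting at time 2 needs \<open>v 3\<close>, which the induction
          hypothesis does not cover when \<open>n = 3\<close>; \<open>laurent_3\<close> supplies
          it.\<close>
        show "orbit_s Xf (Suc 2) \<in> laurent_ring" "orbit_t Xf (Suc 2) \<in> laurent_ring"
          using laurent_3[OF orbit_r1_nonzero] by (simp_all add: numeral_3_eq_3 numeral_2_eq_2)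
        have "2 + (n - 2) = n" using False by simp
        then show "z = orbit_r Xf (2 + (n - 2)) \<or> z = orbit_s Xf (2 + (n - 2)) \<or> z = orbit_t Xf (2 + (n - 2))"
          using z by simp
      qed (use less False nz laurent_2 in auto)
      then obtain l where l: "orbit_r Xf 2 ^ l * z \<in> laurent_ring" ..
      \<comment> \<open>Since \<open>Q(v 1) = r 0 * r 1\<close>, powers of \<open>r 1\<close> can be
        traded for powers of \<open>Q\<close>, whose coprimality to \<open>r 2\<close> is
        known.\<close>
      have "Q ^ k * z = Xf 12 ^ k * (orbit_r Xf 1 ^ k * z)"
        unfolding orbit_r1 Q_def[symmetric] by (simp add: power_mult_distrib field_simps)
      also have "\<dots> \<in> laurent_ring"
        by (rule localised_mult[OF localised_power[OF localised_var] k]) simp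
      finally have Q: "Q ^ k * z \<in> laurent_ring" .
      have "Q \<in> laurent_ring"
        unfolding Q_def by (intro localised_QQ localised_var) auto
      then have cop: "coprime_in {..<17} (orbit_r Xf 2 ^ l) (Q ^ k)"
        using coprime_r2_QQ r2_mem QQ_initial_nonzero nz[of 2] False
        by (intro coprime_in_powers) (auto simp: Q_def)
      show ?thesis
        by (rule coprime_in_quotient[OF cop _ l Q]) (simp add: Q_def QQ_initial_nonzero)
    qed
    then show ?thesis unfolding laurent_at_def by blast
  qed
qed

theorem theorem8:
  fixes n :: nat
  defines "rst \<equiv> qrt genA genB (Xf 12) (Xf 13) (Xf 14) (Xf 15) (Xf 16) n"
  shows "in_Rhat (fst rst) \<and> in_Rhat (fst (snd rst)) \<and> in_Rhat (snd (snd rst))"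
proof -
  have "genA = matA Xf" "genB = matB Xf"
    by (simp_all add: fun_eq_iff genA_def genB_def matA_def matB_def)
  then have "rst = orbit Xf n" by (simp add: rst_def orbit_def)
  then show ?thesis
    using laurent_at_all[of n]
    by (simp add: laurent_at_def orbit_r_def orbit_s_def orbit_t_def localised_in_Rhat)
qed

end
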